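(* Let $n\ge 1$ and let $D\subseteq[n]\times[n]$ be a diagram, with dual flagged Weyl character $\chi_D(x)$. Then \[ \chi_D(x)=\sum_{C\le D}x^C \] (i.e. $\chi_D(x)$ attains its upper bound) if and only if there do not exist $1\le i_1<i_2\le n$ and $1\le j_1<j_2\le n$ such that the boxes $(i_1,j_1)$ and $(i_1,j_2)$ do not belong to $D$, while the boxes $(i_2,j_1)$ and $(i_2,j_2)$ both belong to $D$.
   Context: Write $[n]=\{1,\dots,n\}$. A diagram is a subset $D\subseteq[n]\times[n]$ of boxes; $(i,j)$ denotes the box in row $i$ and column $j$ (matrix coordinates). We identify $D$ with the sequence $(D_1,\dots,D_n)$ of subsets of $[n]$, where $i\in D_j$ iff $(i,j)\in D$. Gale order: for $R=\{r_1<\dots<r_m\}$ and $S=\{s_1<\dots<s_m\}$ subsets of $[n]$ of the same size, $R\le S$ means $r_k\le s_k$ for all $k$. For diagrams $C=(C_1,\dots,C_n)$ and $D=(D_1,\dots,D_n)$, $C\le D$ means $|C_j|=|D_j|$ and $C_j\le D_j$ for every $j$. For a diagram $C$, set $x^C=\prod_{j=1}^n\prod_{i\in C_j}x_i$. Let $Y$ be the upper-triangular $n\times n$ matrix whose $(i,j)$ entry is an indeterminate $y_{ij}$ for $i\le j$ and $0$ for $i>j$, and let $\mathbb{C}[Y]$ be the polynomial ring in the $y_{ij}$, $i\le j$. The group $B$ of invertible upper-triangular complex $n\times n$ matrices acts on the right on $\mathbb{C}[Y]$ by $(f\cdot b)(Y)=f(b^{-1}Y)$. For $R,S\subseteq[n]$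 of equal size, $Y^R_S$ is the submatrix of $Y$ with rows indexed by $R$ and columns indexed by $S$. For diagrams $C\le D$, set $\det(Y_D^C)=\prod_{j=1}^n\det(Y^{C_j}_{D_j})$. The flagged Weyl module is the $B$-module $\mathcal{M}_D=\mathrm{Span}_{\mathbb{C}}\{\det(Y_D^C): C\le D\}\subseteq\mathbb{C}[Y]$. Its character is $\mathrm{char}(\mathcal{M}_D)(x_1,\dots,x_n)=\mathrm{tr}(X:\mathcal{M}_D\to\mathcal{M}_D)$, where $X$ is the diagonal matrix with diagonal entries $x_1,\dots,x_n$, and its dual character is $\chi_D(x)=\mathrm{char}(\mathcal{M}_D)(x_1^{-1},\dots,x_n^{-1})$. One always has the coefficientwise inequality $\chi_D(x)\le\sum_{C\le D}x^C$, the sum being over all diagrams $C\le D$. *)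

theory Defs
  imports
    Complex_Main
    "HOL-Library.Poly_Mapping"
    "Jordan_Normal_Form.Determinant"
    "Jordan_Normal_Form.Gauss_Jordan_Elimination"
    "Jordan_Normal_Form.DL_Submatrix"
begin

text \<open>
  Since matrices of \<^typ>\<open>'a mat\<close> are indexed from 0, the index set [n] is \<^term>\<open>{..<n}\<close>
  throughout, and the variables are \<open>x 0, \<dots>, x (n - 1)\<close>.
\<close>


subsection \<open>Diagrams and the Gale order\<close>

type_synonym diagram = "(nat \<times> nat) set"

definition is_diagram :: "nat \<Rightarrow> diagram \<Rightarrow> bool" where
  "is_diagram n D \<longleftrightarrow> D \<subseteq> {..<n} \<times> {..<n}"

definition column :: "diagram \<Rightarrow> nat \<Rightarrow> nat set" where
  "column D j = {i. (i, j) \<in> D}"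

text \<open>\<^term>\<open>pick S k\<close> is the \<open>k\<close>-th smallest element of \<open>S\<close>, counting from 0.\<close>

definition gale_le :: "nat set \<Rightarrow> nat set \<Rightarrow> bool" where
  "gale_le R S \<longleftrightarrow> card R = card S \<and> (\<forall>k<card R. pick R k \<le> pick S k)"

definition diagrams_below :: "nat \<Rightarrow> diagram \<Rightarrow> diagram set" where
  "diagrams_below n D =
    {C. is_diagram n C \<and> (\<forall>j<n. gale_le (column C j) (column D j))}"

definition diagram_monomial :: "nat \<Rightarrow> (nat \<Rightarrow> complex) \<Rightarrow> diagram \<Rightarrow> complex" where
  "diagram_monomial n x C = (\<Prod>j<n. \<Prod>i\<in>column C j. x i)"


subsection \<open>The polynomial ring and the action of upper-triangular matrices\<close>

text \<open>
  Polynomials over the complex numbers in indeterminates indexed by pairs of naturals: finitely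
  supported maps from monomials (finitely supported exponent functions) to coefficients. The ring
  \<open>\<complex>[Y]\<close> is the subring of polynomials in the \<open>(i, j)\<close> with \<open>i \<le> j < n\<close>.
\<close>

type_synonym ypoly = "((nat \<times> nat) \<Rightarrow>\<^sub>0 nat) \<Rightarrow>\<^sub>0 complex"

definition yconst :: "complex \<Rightarrow> ypoly" where
  "yconst c = Poly_Mapping.single 0 c"

definition yvar :: "nat \<times> nat \<Rightarrow> ypoly" where
  "yvar v = Poly_Mapping.single (Poly_Mapping.single v 1) 1"

definition yscale :: "complex \<Rightarrow> ypoly \<Rightarrow> ypoly" where
  "yscale c f = yconst c * f"

global_interpretation ypoly: vector_space yscale
  by unfold_locales
    (simp_all add: yscale_def yconst_def single_add mult_single algebra_simps flip: mult.assoc)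

definition ysubst :: "(nat \<times> nat \<Rightarrow> ypoly) \<Rightarrow> ypoly \<Rightarrow> ypoly" where
  "ysubst g f =
    (\<Sum>m\<in>Poly_Mapping.keys f. yconst (Poly_Mapping.lookup f m) *
      (\<Prod>v\<in>Poly_Mapping.keys m. g v ^ Poly_Mapping.lookup m v))"

definition Y_mat :: "nat \<Rightarrow> ypoly mat" where
  "Y_mat n = mat n n (\<lambda>(i, j). if i \<le> j then yvar (i, j) else 0)"

text \<open>
  \<open>(f \<cdot> b)(Y) = f(b\<^sup>-\<^sup>1 Y)\<close> for \<open>b\<close> an invertible upper-triangular \<open>n \<times> n\<close> matrix (otherwise the
  value is of no interest): each \<open>y\<^sub>i\<^sub>j\<close> is replaced by the \<open>(i, j)\<close> entry of \<open>b\<^sup>-\<^sup>1 Y\<close>.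
\<close>

definition borel_act :: "nat \<Rightarrow> ypoly \<Rightarrow> complex mat \<Rightarrow> ypoly" where
  "borel_act n f b =
    ysubst (\<lambda>(i, j). (map_mat yconst (the (mat_inverse b)) * Y_mat n) $$ (i, j)) f"


subsection \<open>Flagged Weyl modules and their characters\<close>

definition diagram_det :: "nat \<Rightarrow> diagram \<Rightarrow> diagram \<Rightarrow> ypoly" where
  "diagram_det n C D = (\<Prod>j<n. det (submatrix (Y_mat n) (column C j) (column D j)))"

definition flagged_weyl_module :: "nat \<Rightarrow> diagram \<Rightarrow> ypoly set" where
  "flagged_weyl_module n D = ypoly.span ((\<lambda>C. diagram_det n C D) ` diagrams_below n D)"

text \<open>
  Trace of a linear endomorphism \<open>T\<close> of a finite-dimensional subspace \<open>V\<close>: the sum of the diagonal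
  matrix entries with respect to a basis of \<open>V\<close>, whose choice is immaterial.
\<close>

definition trace_on :: "ypoly set \<Rightarrow> (ypoly \<Rightarrow> ypoly) \<Rightarrow> complex" where
  "trace_on V T =
    (let E = (SOME E. ypoly.independent E \<and> ypoly.span E = V)
     in \<Sum>e\<in>E. ypoly.representation E (T e) e)"

text \<open>The characters are regarded as functions of \<open>x\<close> with \<open>x i \<noteq> 0\<close> for all \<open>i < n\<close>.\<close>

definition weyl_char :: "nat \<Rightarrow> diagram \<Rightarrow> (nat \<Rightarrow> complex) \<Rightarrow> complex" where
  "weyl_char n D x =
    trace_on (flagged_weyl_module n D) (\<lambda>f. borel_act n f (mat_diag n x))"

definition dual_weyl_char :: "nat \<Rightarrow> diagram \<Rightarrow> (nat \<Rightarrow> complex) \<Rightarrow> complex" where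
  "dual_weyl_char n D x = weyl_char n D (\<lambda>i. inverse (x i))"

end

theory Submission
  imports Defs
begin

text \<open>
  At \<open>x = 1\<close> the character is the dimension of the module, and every product of minors indexed by
  some \<open>C \<le> D\<close> is a weight vector of weight \<open>x\<^sup>C\<close>. Hence the upper bound is attained if and only if
  these products of minors, taken over all \<open>C \<le> D\<close>, are linearly independent.

  Because \<open>Y\<close> is upper triangular, the monomials of the product indexed by \<open>C\<close> correspond to families
  of bijections \<open>G j\<close> from column \<open>j\<close> of \<open>D\<close> to column \<open>j\<close> of \<open>C\<close> with \<open>G j s \<le> s\<close>. Suppose the forbidden
  configuration does not occur. In a family of minimal \<open>\<Sum> G j s * s\<close>, every \<open>G j s \<noteq> s\<close> is absent from
  column \<open>j\<close> of \<open>D\<close>, by exchanging two values. A factor \<open>y\<^sub>r\<^sub>s\<close> with \<open>r < s\<close> then comes from the unique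
  column of \<open>D\<close> that contains \<open>s\<close> but not \<open>r\<close>, so the monomial determines the family and cannot cancel
  in a linear relation.

  Conversely, take a configuration in rows \<open>p < q\<close> with \<open>q - p\<close> minimal, so that every row strictly
  between \<open>p\<close> and \<open>q\<close> lies in exactly one of the two columns \<open>A\<close>, \<open>B\<close>. The square matrix with rows
  \<open>p, \<dots>, q\<close> and columns \<open>A \<inter> {p..q}\<close> followed by \<open>B \<inter> {p..q}\<close> has the column \<open>q\<close> twice; the Laplace
  expansion of its vanishing determinant is a nontrivial relation.
\<close>


subsection \<open>Enumerations of finite sets\<close>

text \<open>On \<open>S\<close> this inverts \<open>pick S\<close>. It makes sense for
  \<open>s\<close> outside \<open>S\<close> as well, which the sign computations use to locate a
  deleted row among the remaining ones.\<close>

definition position :: "nat set \<Rightarrow> nat \<Rightarrow> nat" where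
  "position S s = card {a \<in> S. a < s}"

lemma position_less_card:
  assumes "finite S" "s \<in> S"
  shows "position S s < card S"
  unfolding position_def by (rule psubset_card_mono) (use assms in auto)

lemma pick_position: "s \<in> S \<Longrightarrow> pick S (position S s) = s"
  unfolding position_def by (rule pick_card_in_set)

lemma position_pick: "k < card S \<Longrightarrow> position S (pick S k) = k"
  unfolding position_def by (rule card_pick_le)

lemma pick_eqI: "s \<in> S \<Longrightarrow> position S s = k \<Longrightarrow> pick S k = s"
  using pick_position by blast

lemma bij_betw_pick:
  assumes "finite S"
  shows "bij_betw (pick S) {..<card S} S"
  by (rule bij_betw_byWitness[where f' = "position S"])
    (use assms in \<open>auto simp: pick_position position_pick position_less_card intro: pick_in_set_le\<close>)

lemma bij_betw_position:
  assumes "finite S"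
  shows "bij_betw (position S) S {..<card S}"
  by (rule bij_betw_byWitness[where f' = "pick S"])
    (use assms in \<open>auto simp: pick_position position_pick position_less_card intro: pick_in_set_le\<close>)

lemma position_remove:
  assumes "finite R" "r \<in> R"
  shows "position R x = position (R - {r}) x + (if r < x then 1 else 0)"
proof (cases "r < x")
  case True
  then have "{a \<in> R. a < x} = insert r {a \<in> R - {r}. a < x}"
    using assms by auto
  with True show ?thesis
    unfolding position_def using assms by simp
next
  case False
  then have "{a \<in> R. a < x} = {a \<in> R - {r}. a < x}" by auto
  with False show ?thesis unfolding position_def by simp
qed

text \<open>The index shift is that of \<open>mat_delete\<close>, so deleting a row and a column of
  a submatrix gives a submatrix again.\<close>

lemma pick_remove:
  assumes "finite R" "k < card R" "i < card R - 1"
  shows "pick (R - {pick R k}) i = pick R (if i < k then i else Suc i)"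
proof -
  let ?l = "if i < k then i else Suc i"
  have l: "?l < card R" "?l \<noteq> k" using assms by auto
  have k: "pick R k \<in> R" using assms pick_in_set_le by blast
  have "pick R k \<noteq> pick R ?l"
    using l assms(2) by (metis position_pick)
  then have "pick R ?l \<in> R - {pick R k}"
    using pick_in_set_le[OF l(1)] by auto
  moreover have "position (R - {pick R k}) (pick R ?l) = i"
  proof -
    have "pick R k < pick R ?l \<longleftrightarrow> k < ?l"
      by (metis assms(2) l not_less_iff_gr_or_eq pick_mono_le)
    then show ?thesis
      using position_remove[OF assms(1) k, of "pick R ?l"] position_pick[OF l(1)]
      by (auto split: if_splits)
  qed
  ultimately show ?thesis by (rule pick_eqI)
qed


subsection \<open>Monomial expansion of minors\<close>

text \<open>These index the Leibniz terms of a minor that avoid the zero entries of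
  \<open>Y\<close>. Extensionality makes equality of fillings the same as agreement on
  \<open>S\<close>.\<close>

definition fillings :: "nat set \<Rightarrow> nat set \<Rightarrow> (nat \<Rightarrow> nat) set" where
  "fillings R S = {g \<in> S \<rightarrow>\<^sub>E R. bij_betw g S R \<and> (\<forall>s\<in>S. g s \<le> s)}"

text \<open>The bijection \<open>g\<close> is transported to indices along the increasing
  enumerations. Being the identity from \<open>card S\<close> on makes it a permutation in the sense
  of \<open>permutes\<close>, with the sign of the Leibniz term.\<close>

definition filling_perm :: "nat set \<Rightarrow> nat set \<Rightarrow> (nat \<Rightarrow> nat) \<Rightarrow> nat \<Rightarrow> nat" where
  "filling_perm R S g i = (if i < card S then position R (g (pick S i)) else i)"

definition filling_monomial :: "nat set \<Rightarrow> (nat \<Rightarrow> nat) \<Rightarrow> (nat \<times> nat) \<Rightarrow>\<^sub>0 nat" where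
  "filling_monomial S g = (\<Sum>s\<in>S. Poly_Mapping.single (g s, s) 1)"

lemma prod_single:
  fixes c :: "'a \<Rightarrow> 'c :: comm_semiring_1" and m :: "'a \<Rightarrow> 'b :: comm_monoid_add"
  shows "finite A \<Longrightarrow> (\<Prod>i\<in>A. Poly_Mapping.single (m i) (c i)) =
    Poly_Mapping.single (\<Sum>i\<in>A. m i) (\<Prod>i\<in>A. c i)"
  by (induction rule: finite_induct) (auto simp: mult_single)

abbreviation minor :: "nat \<Rightarrow> nat set \<Rightarrow> nat set \<Rightarrow> ypoly" where
  "minor n R S \<equiv> det (submatrix (Y_mat n) R S)"

lemma dim_Y_mat [simp]: "dim_row (Y_mat n) = n" "dim_col (Y_mat n) = n"
  by (simp_all add: Y_mat_def)

lemma restricted_index_set: "R \<subseteq> {..<n} \<Longrightarrow> {i. i < n \<and> i \<in> R} = R"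
  by auto

lemma submatrix_Y_mat_carrier:
  assumes "R \<subseteq> {..<n}" "S \<subseteq> {..<n}"
  shows "submatrix (Y_mat n) R S \<in> carrier_mat (card R) (card S)"
  using assms by (intro carrier_matI) (simp_all add: dim_submatrix restricted_index_set)

lemma submatrix_Y_mat_index:
  assumes "R \<subseteq> {..<n}" "S \<subseteq> {..<n}" "i < card R" "j < card S"
  shows "submatrix (Y_mat n) R S $$ (i, j) = Y_mat n $$ (pick R i, pick S j)"
  using assms by (simp add: submatrix_index restricted_index_set)

text \<open>In the Leibniz formula, permutations of indices are replaced by bijections from
  \<open>S\<close> to \<open>R\<close>. A bijection with some \<open>g s > s\<close> contributes
  zero, since it uses an entry below the diagonal of \<open>Y\<close>.\<close>

lemma minor_expansion:
  assumes R: "R \<subseteq> {..<n}" and S: "S \<subseteq> {..<n}" and card: "card R = card S"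
  shows "minor n R S = (\<Sum>g\<in>fillings R S.
    Poly_Mapping.single (filling_monomial S g) (of_int (sign (filling_perm R S g))))"
proof -
  let ?k = "card S"
  have fin: "finite R" "finite S" using R S finite_subset by auto
  note bpS = bij_betw_pick[OF fin(2)] and bpR = bij_betw_pick[OF fin(1)]
  note bqS = bij_betw_position[OF fin(2)] and bqR = bij_betw_position[OF fin(1)]
  let ?B = "{g \<in> S \<rightarrow>\<^sub>E R. bij_betw g S R}"
  let ?h = "\<lambda>p. \<lambda>s\<in>S. pick R (p (position S s))"
  let ?Y = "\<lambda>r s. Y_mat n $$ (r, s)"
  have pickS: "i < ?k \<Longrightarrow> pick S i \<in> S" for i by (rule pick_in_set_le)
  have perm: "filling_perm R S g permutes {0..<?k}" if g: "bij_betw g S R" for g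
  proof (rule bij_imp_permutes)
    have "bij_betw (position R \<circ> g \<circ> pick S) {..<?k} {..<?k}"
      using bpS g bqR card by (auto intro!: bij_betw_trans)
    moreover have "bij_betw (filling_perm R S g) {..<?k} {..<?k} =
        bij_betw (position R \<circ> g \<circ> pick S) {..<?k} {..<?k}"
      by (rule bij_betw_cong) (simp add: filling_perm_def)
    ultimately show "bij_betw (filling_perm R S g) {0..<?k} {0..<?k}"
      by (simp add: lessThan_atLeast0)
  qed (auto simp: filling_perm_def)
  have "minor n R S = (\<Sum>p | p permutes {0..<?k}. of_int (sign p) *
      (\<Prod>j<?k. submatrix (Y_mat n) R S $$ (p j, j)))"
    by (rule det_col) (use submatrix_Y_mat_carrier[OF R S] card in simp)
  also have "\<dots> = (\<Sum>p | p permutes {0..<?k}. of_int (sign p) *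
      (\<Prod>j<?k. ?Y (pick R (p j)) (pick S j)))"
  proof (intro sum.cong refl arg_cong2[of _ _ _ _ times] prod.cong)
    fix p j assume p: "p \<in> {p. p permutes {0..<?k}}" and j: "j \<in> {..<?k}"
    then have "p j < ?k" using permutes_in_image[of p "{0..<?k}" j] by simp
    then show "submatrix (Y_mat n) R S $$ (p j, j) = ?Y (pick R (p j)) (pick S j)"
      using R S card j by (simp add: submatrix_Y_mat_index)
  qed
  also have "\<dots> = (\<Sum>g\<in>?B. of_int (sign (filling_perm R S g)) * (\<Prod>s\<in>S. ?Y (g s) s))"
  proof (rule sum.reindex_bij_witness[where j = ?h and i = "filling_perm R S"])
    fix p assume p': "p \<in> {p. p permutes {0..<?k}}"
    then have p: "p permutes {..<?k}" by (simp add: lessThan_atLeast0)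
    have lt: "i < ?k \<Longrightarrow> p i < ?k" for i using permutes_in_image[OF p, of i] by simp
    show eq: "filling_perm R S (?h p) = p"
    proof
      fix i show "filling_perm R S (?h p) i = p i"
        using p lt[of i] pickS[of i] card
        by (auto simp: filling_perm_def position_pick permutes_not_in)
    qed
    have "bij_betw (pick R \<circ> p \<circ> position S) S R"
      using bqS permutes_imp_bij[OF p] bpR card by (auto intro!: bij_betw_trans)
    then have bij: "bij_betw (?h p) S R"
      by (rule bij_betw_cong[THEN iffD1, rotated]) auto
    then show "?h p \<in> ?B" by (auto dest: bij_betw_apply)
    have "(\<Prod>s\<in>S. ?Y (?h p s) s) = (\<Prod>j<?k. ?Y (?h p (pick S j)) (pick S j))"
      by (rule prod.reindex_bij_betw[OF bpS, symmetric])
    also have "\<dots> = (\<Prod>j<?k. ?Y (pick R (p j)) (pick S j))"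
      by (intro prod.cong refl) (simp add: pickS position_pick)
    finally show "of_int (sign (filling_perm R S (?h p))) * (\<Prod>s\<in>S. ?Y (?h p s) s) =
      of_int (sign p) * (\<Prod>j<?k. ?Y (pick R (p j)) (pick S j))"
      unfolding eq by simp
  next
    fix g assume g: "g \<in> ?B"
    then show "filling_perm R S g \<in> {p. p permutes {0..<?k}}" using perm by blast
    show "?h (filling_perm R S g) = g"
    proof
      fix s show "?h (filling_perm R S g) s = g s"
      proof (cases "s \<in> S")
        case True
        then have "g s \<in> R" using g by auto
        then show ?thesis
          using True position_less_card[OF fin(2) True] by (simp add: filling_perm_def pick_position)
      next
        case False
        then show ?thesis using g by (auto simp: PiE_arb[of g S])
      qed
    qed
  qed
  also have "\<dots> = (\<Sum>g\<in>fillings R S. of_int (sign (filling_perm R S g)) * (\<Prod>s\<in>S. ?Y (g s) s))"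
  proof (rule sum.mono_neutral_right)
    show "finite ?B" by (rule finite_subset[of _ "S \<rightarrow>\<^sub>E R"]) (use fin in \<open>auto intro: finite_PiE\<close>)
    show "fillings R S \<subseteq> ?B" by (auto simp: fillings_def)
    show "\<forall>g\<in>?B - fillings R S.
      of_int (sign (filling_perm R S g)) * (\<Prod>s\<in>S. ?Y (g s) s) = 0"
    proof
      fix g assume g: "g \<in> ?B - fillings R S"
      then obtain s where s: "s \<in> S" "\<not> g s \<le> s" by (auto simp: fillings_def)
      moreover have "g s \<in> R" using g s by auto
      ultimately have "?Y (g s) s = 0" using R S by (auto simp: Y_mat_def)
      then have "(\<Prod>s\<in>S. ?Y (g s) s) = 0" using s fin by (intro prod_zero) auto
      then show "of_int (sign (filling_perm R S g)) * (\<Prod>s\<in>S. ?Y (g s) s) = 0" by simp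
    qed
  qed
  also have "\<dots> = (\<Sum>g\<in>fillings R S.
    Poly_Mapping.single (filling_monomial S g) (of_int (sign (filling_perm R S g))))"
  proof (intro sum.cong refl)
    fix g assume g: "g \<in> fillings R S"
    have "(\<Prod>s\<in>S. ?Y (g s) s) =
      (\<Prod>s\<in>S. Poly_Mapping.single (Poly_Mapping.single (g s, s) 1) 1)"
    proof (intro prod.cong refl)
      fix s assume s: "s \<in> S"
      then have "g s \<in> R" "g s \<le> s" using g by (auto simp: fillings_def)
      then show "?Y (g s) s = Poly_Mapping.single (Poly_Mapping.single (g s, s) 1) 1"
        using s R S by (auto simp: Y_mat_def yvar_def)
    qed
    also have "\<dots> = Poly_Mapping.single (filling_monomial S g) 1"
      by (simp add: prod_single fin filling_monomial_def)
    finally show "of_int (sign (filling_perm R S g)) * (\<Prod>s\<in>S. ?Y (g s) s) =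
      Poly_Mapping.single (filling_monomial S g) (of_int (sign (filling_perm R S g)))"
      by (simp add: mult_single flip: single_of_int)
  qed
  finally show ?thesis .
qed

text \<open>As \<open>g s \<le> s\<close>, the filling maps elements below \<open>m\<close>
  injectively to elements below \<open>m\<close>.\<close>

lemma card_below_le_of_filling:
  assumes "finite R" "g \<in> fillings R S"
  shows "card {s \<in> S. s < m} \<le> card {r \<in> R. r < m}"
proof (rule card_inj_on_le)
  show "inj_on g {s \<in> S. s < m}"
    using assms by (auto simp: fillings_def bij_betw_def intro: inj_on_subset)
  show "g ` {s \<in> S. s < m} \<subseteq> {r \<in> R. r < m}"
    using assms by (force simp: fillings_def)
qed (use assms in simp)

text \<open>Matching elements of equal rank gives a filling when \<open>R \<le> S\<close>.
  Conversely, if \<open>pick R k > pick S k\<close>, then \<open>S\<close> has at least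
  \<open>k + 1\<close> elements up to \<open>pick S k\<close> but \<open>R\<close> has at most
  \<open>k\<close>, against the counting inequality for fillings.\<close>

lemma gale_le_iff_fillings:
  assumes "finite R" "finite S"
  shows "gale_le R S \<longleftrightarrow> fillings R S \<noteq> {}"
proof
  assume gale: "gale_le R S"
  then have card: "card R = card S" by (simp add: gale_le_def)
  let ?g = "\<lambda>s\<in>S. pick R (position S s)"
  have "bij_betw (pick R \<circ> position S) S R"
    using bij_betw_position[OF assms(2)] bij_betw_pick[OF assms(1)] card
    by (auto intro!: bij_betw_trans)
  then have bij: "bij_betw ?g S R"
    by (rule bij_betw_cong[THEN iffD1, rotated]) auto
  moreover have "?g s \<le> s" if "s \<in> S" for s
    using gale that position_less_card[OF assms(2) that] pick_position[OF that]
    by (auto simp: gale_le_def)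
  ultimately have "?g \<in> fillings R S" by (auto simp: fillings_def dest: bij_betw_apply)
  then show "fillings R S \<noteq> {}" by blast
next
  assume "fillings R S \<noteq> {}"
  then obtain g where g: "g \<in> fillings R S" by blast
  then have card: "card R = card S" using bij_betw_same_card by (fastforce simp: fillings_def)
  have "pick R k \<le> pick S k" if k: "k < card R" for k
  proof (rule ccontr)
    assume less: "\<not> pick R k \<le> pick S k"
    have kS: "k < card S" using k card by simp
    have "Suc k = card (insert (pick S k) {s \<in> S. s < pick S k})"
      using card_pick_le[OF kS] assms by simp
    also have "\<dots> \<le> card {s \<in> S. s < Suc (pick S k)}"
      by (rule card_mono) (use assms pick_in_set_le[OF kS] in auto)
    also have "\<dots> \<le> card {r \<in> R. r < Suc (pick S k)}"
      by (rule card_below_le_of_filling[OF assms(1) g])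
    also have "\<dots> \<le> card {r \<in> R. r < pick R k}"
      by (rule card_mono) (use assms less in auto)
    also have "\<dots> = k" by (rule card_pick_le[OF k])
    finally show False by simp
  qed
  with card show "gale_le R S" by (simp add: gale_le_def)
qed

lemma minor_eq_0:
  assumes "R \<subseteq> {..<n}" "S \<subseteq> {..<n}" "card R = card S" "fillings R S = {}"
  shows "minor n R S = 0"
  using minor_expansion[OF assms(1-3)] assms(4) by simp

text \<open>This is Laplace expansion along a column, with rows and columns named by their labels in
  \<open>Y\<close>; \<open>position\<close> recovers the indices that enter the sign.\<close>

lemma minor_expand_column:
  assumes R: "R \<subseteq> {..<n}" and S: "S \<subseteq> {..<n}" and card: "card R = card S" and s: "s \<in> S"
  shows "minor n R S = (\<Sum>r\<in>R. (-1) ^ (position R r + position S s) *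
    (Y_mat n $$ (r, s) * minor n (R - {r}) (S - {s})))"
proof -
  have fin: "finite R" "finite S" using R S finite_subset by auto
  let ?k = "card S" and ?A = "submatrix (Y_mat n) R S" and ?j = "position S s"
  have j: "?j < ?k" by (rule position_less_card[OF fin(2) s])
  have A: "?A \<in> carrier_mat ?k ?k" using submatrix_Y_mat_carrier[OF R S] card by simp
  have del: "mat_delete ?A i ?j = submatrix (Y_mat n) (R - {pick R i}) (S - {s})"
    if i: "i < ?k" for i
  proof -
    have R': "R - {pick R i} \<subseteq> {..<n}" and S': "S - {s} \<subseteq> {..<n}" using R S by auto
    have c: "card (R - {pick R i}) = ?k - 1" "card (S - {s}) = ?k - 1"
      using card i s fin pick_in_set_le[of i R] by (simp_all add: card_Diff_singleton)
    show ?thesis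
    proof (rule eq_matI)
      fix a b assume "a < dim_row (submatrix (Y_mat n) (R - {pick R i}) (S - {s}))"
        "b < dim_col (submatrix (Y_mat n) (R - {pick R i}) (S - {s}))"
      then have ab: "a < ?k - 1" "b < ?k - 1"
        using submatrix_Y_mat_carrier[OF R' S'] c by auto
      let ?a = "if a < i then a else Suc a" and ?b = "if b < ?j then b else Suc b"
      have "mat_delete ?A i ?j $$ (a, b) = ?A $$ (?a, ?b)"
        using ab A by (simp add: mat_delete_def)
      also have "\<dots> = Y_mat n $$ (pick R ?a, pick S ?b)"
        by (rule submatrix_Y_mat_index[OF R S]) (use ab card in auto)
      also have "pick R ?a = pick (R - {pick R i}) a"
        by (rule pick_remove[symmetric]) (use fin ab card i in auto)
      also have "pick S ?b = pick (S - {pick S ?j}) b"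
        by (rule pick_remove[symmetric]) (use fin ab j in auto)
      also have "pick S ?j = s" by (rule pick_position[OF s])
      finally show "mat_delete ?A i ?j $$ (a, b) =
          submatrix (Y_mat n) (R - {pick R i}) (S - {s}) $$ (a, b)"
        using submatrix_Y_mat_index[OF R' S'] ab c by simp
    qed (use submatrix_Y_mat_carrier[OF R' S'] A c in auto)
  qed
  have "minor n R S = (\<Sum>i<?k. ?A $$ (i, ?j) * cofactor ?A i ?j)"
    by (rule laplace_expansion_column[OF A j])
  also have "\<dots> = (\<Sum>i<card R. (-1) ^ (position R (pick R i) + ?j) *
      (Y_mat n $$ (pick R i, s) * minor n (R - {pick R i}) (S - {s})))"
    using card j by (intro sum.cong)
      (simp_all add: cofactor_def del submatrix_Y_mat_index[OF R S] position_pick pick_position[OF s])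
  also have "\<dots> = (\<Sum>r\<in>R. (-1) ^ (position R r + position S s) *
    (Y_mat n $$ (r, s) * minor n (R - {r}) (S - {s})))"
    by (rule sum.reindex_bij_betw[OF bij_betw_pick[OF fin(1)]])
  finally show ?thesis .
qed


subsection \<open>Families of vectors and traces\<close>

context vector_space
begin

lemma independent_family:
  assumes fin: "finite I" and ind: "\<And>a. (\<Sum>i\<in>I. a i *s v i) = 0 \<Longrightarrow> \<forall>i\<in>I. a i = 0"
  shows "inj_on v I" "independent (v ` I)"
proof -
  show inj: "inj_on v I"
  proof
    fix i j assume ij: "i \<in> I" "j \<in> I" "v i = v j"
    show "i = j"
    proof (rule ccontr)
      assume ne: "i \<noteq> j"
      \<comment> \<open>If two members of the family coincided, their difference would be a
        nontrivial relation.\<close>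
      let ?a = "\<lambda>k. if k = i then 1 else if k = j then - 1 else (0::'a)"
      have "(\<Sum>k\<in>I. ?a k *s v k) = (\<Sum>k\<in>{i, j}. ?a k *s v k)"
        using fin ij by (intro sum.mono_neutral_right) auto
      also have "\<dots> = 0" using ne ij by simp
      finally have "\<forall>k\<in>I. ?a k = 0" by (rule ind)
      then show False using ij by auto
    qed
  qed
  show "independent (v ` I)"
  proof (rule independent_if_scalars_zero)
    fix f x assume f: "(\<Sum>x\<in>v ` I. f x *s x) = 0" and x: "x \<in> v ` I"
    have "(\<Sum>i\<in>I. f (v i) *s v i) = 0"
      using f by (simp add: sum.reindex inj)
    then show "f x = 0" using ind[of "\<lambda>i. f (v i)"] x by auto
  qed (use fin in simp)
qed

text \<open>A relation with \<open>a k \<noteq> 0\<close> puts \<open>v k\<close> into the span of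
  the other vectors. Then fewer than \<open>card I\<close> vectors would span the independent set
  \<open>B\<close> of size \<open>card I\<close>.\<close>

lemma family_independent_of_card_basis:
  assumes fin: "finite I" and B: "independent B" "B \<subseteq> span (v ` I)" "v ` I \<subseteq> span B"
    and card: "card B = card I" and sum: "(\<Sum>i\<in>I. a i *s v i) = 0" and k: "k \<in> I"
  shows "a k = 0"
proof (rule ccontr)
  assume ak: "a k \<noteq> 0"
  have "a k *s v k + (\<Sum>i\<in>I - {k}. a i *s v i) = 0"
    using sum fin k by (simp add: sum.remove)
  then have "a k *s v k = - (\<Sum>i\<in>I - {k}. a i *s v i)"
    by (simp add: eq_neg_iff_add_eq_0)
  moreover have "v k = inverse (a k) *s (a k *s v k)" using ak by simp
  ultimately have "v k = inverse (a k) *s (- (\<Sum>i\<in>I - {k}. a i *s v i))" by simp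
  then have vk: "v k \<in> span (v ` (I - {k}))"
    by (auto intro!: span_neg span_scale span_sum intro: span_base)
  have "v ` I \<subseteq> span (v ` (I - {k}))"
  proof
    fix x assume "x \<in> v ` I"
    then show "x \<in> span (v ` (I - {k}))"
      using vk by (cases "x = v k") (auto intro: span_base)
  qed
  then have "B \<subseteq> span (v ` (I - {k}))"
    using B(2) span_minimal subspace_span by blast
  from independent_span_bound[OF _ B(1) this]
  have "card B \<le> card (v ` (I - {k}))" using fin by simp
  also have "\<dots> \<le> card (I - {k})" using fin by (intro card_image_le) simp
  also have "\<dots> < card I" using fin k by (rule card_Diff1_less)
  finally show False using card by simp
qed

text \<open>The basis \<open>E\<close> chosen in \<open>trace_on\<close> is unknown, so the trace
  has to be moved to an eigenbasis \<open>F\<close>. The two change-of-basis matrices are inverse to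
  each other, hence the diagonal entries of their product, which multiply the eigenvalues
  \<open>l f\<close>, are 1.\<close>

lemma sum_diagonal_representation:
  assumes E: "independent E" and F: "independent F" "finite F" and span: "span E = span F"
    and T: "\<And>v. v \<in> span F \<Longrightarrow> T v = (\<Sum>f\<in>F. (representation F v f * l f) *s f)"
  shows "(\<Sum>e\<in>E. representation E (T e) e) = (\<Sum>f\<in>F. l f)"
proof -
  have FE: "f \<in> span E" if "f \<in> F" for f using span that span_base by blast
  have EF: "e \<in> span F" if "e \<in> E" for e using span that span_base by blast
  have "finite E"
    using independent_span_bound[OF F(2) E] span span_superset by blast
  have "(\<Sum>e\<in>E. representation E (T e) e) =
      (\<Sum>e\<in>E. \<Sum>f\<in>F. l f * (representation E f e * representation F e f))"
    by (intro sum.cong refl)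
      (simp add: T EF FE representation_sum[OF E] representation_scale[OF E] span_scale mult_ac)
  also have "\<dots> = (\<Sum>f\<in>F. l f * (\<Sum>e\<in>E. representation E f e * representation F e f))"
    by (subst sum.swap) (simp add: sum_distrib_left)
  also have "\<dots> = (\<Sum>f\<in>F. l f)"
  proof (rule sum.cong[OF refl])
    fix f assume f: "f \<in> F"
    have "(\<Sum>e\<in>E. representation E f e * representation F e f) =
        representation F (\<Sum>e\<in>E. representation E f e *s e) f"
      by (simp add: representation_sum[OF F(1)] representation_scale[OF F(1)] EF span_scale)
    also have "(\<Sum>e\<in>E. representation E f e *s e) = f"
      by (rule sum_representation_eq[OF E FE[OF f] \<open>finite E\<close> order_refl])
    also have "representation F f f = 1"
      by (simp add: representation_basis[OF F(1) f])
    finally show "l f * (\<Sum>e\<in>E. representation E f e * representation F e f) = l f" by simp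
  qed
  finally show ?thesis .
qed

end


subsection \<open>The action of diagonal matrices\<close>

lemma lookup_yscale [simp]: "Poly_Mapping.lookup (yscale c f) m = c * Poly_Mapping.lookup f m"
proof -
  have "yscale c f = Poly_Mapping.map ((*) c) f"
    unfolding yscale_def yconst_def by (rule mult_map_scale_conv_mult[symmetric])
  then show ?thesis by (simp add: Poly_Mapping.map.rep_eq when_def)
qed

text \<open>The scalar by which the monomial \<open>m\<close> is multiplied when row
  \<open>i\<close> of \<open>Y\<close> is scaled by \<open>x i\<close>.\<close>

definition row_weight :: "(nat \<Rightarrow> complex) \<Rightarrow> ((nat \<times> nat) \<Rightarrow>\<^sub>0 nat) \<Rightarrow> complex" where
  "row_weight x m = (\<Prod>v\<in>Poly_Mapping.keys m. x (fst v) ^ Poly_Mapping.lookup m v)"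

lemma row_weight_superset:
  assumes "finite A" "Poly_Mapping.keys m \<subseteq> A"
  shows "row_weight x m = (\<Prod>v\<in>A. x (fst v) ^ Poly_Mapping.lookup m v)"
  unfolding row_weight_def
  by (rule prod.mono_neutral_left) (use assms in \<open>auto simp: in_keys_iff\<close>)

lemma row_weight_0 [simp]: "row_weight x 0 = 1"
  by (simp add: row_weight_def)

lemma row_weight_add: "row_weight x (a + b) = row_weight x a * row_weight x b"
proof -
  let ?A = "Poly_Mapping.keys a \<union> Poly_Mapping.keys b"
  have "row_weight x c = (\<Prod>v\<in>?A. x (fst v) ^ Poly_Mapping.lookup c v)"
    if "c \<in> {a, b, a + b}" for c
    by (rule row_weight_superset) (use that Poly_Mapping.keys_add[of a b] in auto)
  then show ?thesis
    by (simp add: lookup_add power_add prod.distrib)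
qed

lemma row_weight_sum: "row_weight x (\<Sum>i\<in>I. m i) = (\<Prod>i\<in>I. row_weight x (m i))"
  by (induction I rule: infinite_finite_induct) (simp_all add: row_weight_add)

lemma row_weight_single [simp]: "row_weight x (Poly_Mapping.single v 1) = x (fst v)"
  by (simp add: row_weight_def)

text \<open>This is the ring \<open>\<complex>[Y]\<close>. On it \<open>borel_act\<close> with a
  diagonal matrix scales monomials; a variable below the diagonal would be sent to zero, and one
  with an index out of range to an unspecified value.\<close>

definition upper_polys :: "nat \<Rightarrow> ypoly set" where
  "upper_polys n =
    {f. \<forall>m\<in>Poly_Mapping.keys f. Poly_Mapping.keys m \<subseteq> {(i, j). i \<le> j \<and> j < n}}"

lemma subspace_upper_polys: "ypoly.subspace (upper_polys n)"
  unfolding ypoly.subspace_def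
proof (intro conjI ballI allI)
  fix f g assume "f \<in> upper_polys n" "g \<in> upper_polys n"
  then show "f + g \<in> upper_polys n"
    using Poly_Mapping.keys_add[of f g] unfolding upper_polys_def by blast
next
  fix c f assume "f \<in> upper_polys n"
  moreover have "Poly_Mapping.keys (yscale c f) \<subseteq> Poly_Mapping.keys f"
    by (auto simp: in_keys_iff)
  ultimately show "yscale c f \<in> upper_polys n"
    unfolding upper_polys_def by blast
qed (simp add: upper_polys_def)

text \<open>Being a unit of the matrix ring guarantees that \<open>mat_inverse\<close> returns
  \<open>Some B\<close>; uniqueness of inverses then identifies \<open>B\<close>.\<close>

lemma mat_inverse_mat_diag:
  fixes x :: "nat \<Rightarrow> complex"
  assumes "\<forall>i<n. x i \<noteq> 0"
  shows "the (mat_inverse (mat_diag n (\<lambda>i. inverse (x i)))) = mat_diag n x"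
proof -
  let ?A = "mat_diag n (\<lambda>i. inverse (x i))"
  have mult: "?A * mat_diag n x = 1\<^sub>m n" "mat_diag n x * ?A = 1\<^sub>m n"
    unfolding mat_diag_mult_left[OF mat_diag_dim]
    using assms by (auto intro!: eq_matI simp: mat_diag_def)
  have "?A \<in> Units (ring_mat TYPE(complex) n undefined)"
    unfolding Units_def using mult by (auto simp: ring_mat_simps intro!: bexI[of _ "mat_diag n x"])
  then obtain B where B: "mat_inverse ?A = Some B"
    using mat_inverse(1)[of ?A n undefined] by auto
  have AB: "?A * B = 1\<^sub>m n" "B \<in> carrier_mat n n"
    using mat_inverse(2)[OF _ B, of n] by auto
  have "B = (mat_diag n x * ?A) * B" using mult AB by simp
  also have "\<dots> = mat_diag n x * (?A * B)" using AB by (intro assoc_mult_mat[of _ n n _ n _ n]) auto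
  also have "\<dots> = mat_diag n x" using AB by (simp add: right_mult_one_mat[of _ n n])
  finally show ?thesis using B by simp
qed

lemma single_power:
  fixes c :: "'c :: comm_semiring_1"
  shows "Poly_Mapping.single (Poly_Mapping.single v (1::nat)) c ^ k =
    Poly_Mapping.single (Poly_Mapping.single v k) (c ^ k)"
  by (induction k) (simp_all add: mult_single flip: single_add)

lemma sum_single_lookup: "(\<Sum>v\<in>Poly_Mapping.keys m. Poly_Mapping.single v (Poly_Mapping.lookup m v)) = m"
  by (rule poly_mapping_eqI) (auto simp: lookup_sum lookup_single when_def in_keys_iff)

text \<open>The inverse in the dual character cancels against the one in the action, so the
  substitution replaces \<open>y\<^sub>i\<^sub>j\<close> by \<open>x i\<close> times itself and
  every monomial is an eigenvector.\<close>

lemma lookup_borel_act_diag: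
  assumes x: "\<forall>i<n. x i \<noteq> 0" and f: "f \<in> upper_polys n"
  shows "Poly_Mapping.lookup (borel_act n f (mat_diag n (\<lambda>i. inverse (x i)))) m =
    row_weight x m * Poly_Mapping.lookup f m"
proof -
  let ?g = "\<lambda>(i, j). (map_mat yconst (mat_diag n x) * Y_mat n) $$ (i, j)"
  have md: "map_mat yconst (mat_diag n x) = mat_diag n (\<lambda>i. yconst (x i))"
    by (auto intro!: eq_matI simp: mat_diag_def yconst_def)
  have Y: "Y_mat n \<in> carrier_mat n n" by (simp add: Y_mat_def)
  have g: "?g v = Poly_Mapping.single (Poly_Mapping.single v 1) (x (fst v))"
    if "v \<in> {(i, j). i \<le> j \<and> j < n}" for v
    using that unfolding md mat_diag_mult_left[OF Y]
    by (auto simp: Y_mat_def yvar_def yconst_def mult_single)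
  have mono: "yconst c * (\<Prod>v\<in>Poly_Mapping.keys m. ?g v ^ Poly_Mapping.lookup m v) =
      Poly_Mapping.single m (c * row_weight x m)"
    if "Poly_Mapping.keys m \<subseteq> {(i, j). i \<le> j \<and> j < n}" for m c
  proof -
    have "(\<Prod>v\<in>Poly_Mapping.keys m. ?g v ^ Poly_Mapping.lookup m v) =
      (\<Prod>v\<in>Poly_Mapping.keys m. Poly_Mapping.single (Poly_Mapping.single v (Poly_Mapping.lookup m v))
        (x (fst v) ^ Poly_Mapping.lookup m v))"
    proof (intro prod.cong refl)
      fix v assume "v \<in> Poly_Mapping.keys m"
      then have "v \<in> {(i, j). i \<le> j \<and> j < n}" using that by blast
      then show "?g v ^ Poly_Mapping.lookup m v =
          Poly_Mapping.single (Poly_Mapping.single v (Poly_Mapping.lookup m v))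
            (x (fst v) ^ Poly_Mapping.lookup m v)"
        by (simp only: g single_power)
    qed
    also have "\<dots> = Poly_Mapping.single m (row_weight x m)"
      by (simp add: prod_single sum_single_lookup row_weight_def)
    finally show ?thesis by (simp add: yconst_def mult_single)
  qed
  have "borel_act n f (mat_diag n (\<lambda>i. inverse (x i))) =
      (\<Sum>k\<in>Poly_Mapping.keys f. Poly_Mapping.single k (Poly_Mapping.lookup f k * row_weight x k))"
    unfolding borel_act_def mat_inverse_mat_diag[OF x] ysubst_def
    using f by (intro sum.cong refl mono) (auto simp: upper_polys_def)
  then show ?thesis
    by (auto simp: lookup_sum lookup_single when_def in_keys_iff)
qed


subsection \<open>Monomial expansion of the spanning vectors\<close>

lemma column_subset: "is_diagram n D \<Longrightarrow> column D j \<subseteq> {..<n}"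
  by (auto simp: is_diagram_def column_def)

lemma finite_column: "is_diagram n D \<Longrightarrow> finite (column D j)"
  by (rule finite_subset[OF column_subset]) auto

lemma is_diagram_of_below: "C \<in> diagrams_below n D \<Longrightarrow> is_diagram n C"
  by (simp add: diagrams_below_def)

lemma finite_diagrams_below: "finite (diagrams_below n D)"
  by (rule finite_subset[of _ "Pow ({..<n} \<times> {..<n})"])
    (auto simp: diagrams_below_def is_diagram_def)

lemma diagram_eqI:
  assumes "is_diagram n C" "is_diagram n C'" "\<And>j. j < n \<Longrightarrow> column C j = column C' j"
  shows "C = C'"
proof (rule Set.set_eqI)
  fix b show "b \<in> C \<longleftrightarrow> b \<in> C'"
  proof (cases "snd b < n")
    case True
    then show ?thesis using assms(3)[of "snd b"]
      by (cases b) (auto simp: column_def set_eq_iff)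
  next
    case False
    then show ?thesis using assms(1,2) by (auto simp: is_diagram_def)
  qed
qed

definition diagram_fillings :: "nat \<Rightarrow> diagram \<Rightarrow> diagram \<Rightarrow> (nat \<Rightarrow> nat \<Rightarrow> nat) set" where
  "diagram_fillings n C D = (\<Pi>\<^sub>E j\<in>{..<n}. fillings (column C j) (column D j))"

definition diagram_filling_monomial ::
    "nat \<Rightarrow> diagram \<Rightarrow> (nat \<Rightarrow> nat \<Rightarrow> nat) \<Rightarrow> (nat \<times> nat) \<Rightarrow>\<^sub>0 nat" where
  "diagram_filling_monomial n D G = (\<Sum>j<n. filling_monomial (column D j) (G j))"

definition diagram_filling_sign :: "nat \<Rightarrow> diagram \<Rightarrow> diagram \<Rightarrow> (nat \<Rightarrow> nat \<Rightarrow> nat) \<Rightarrow> complex" where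
  "diagram_filling_sign n C D G =
    (\<Prod>j<n. of_int (sign (filling_perm (column C j) (column D j) (G j))))"

lemma diagram_filling_sign_nonzero: "diagram_filling_sign n C D G \<noteq> 0"
  by (simp add: diagram_filling_sign_def sign_def)

lemma finite_fillings: "finite R \<Longrightarrow> finite S \<Longrightarrow> finite (fillings R S)"
  by (rule finite_subset[of _ "S \<rightarrow>\<^sub>E R"]) (auto simp: fillings_def intro: finite_PiE)

lemma finite_diagram_fillings:
  assumes "is_diagram n C" "is_diagram n D"
  shows "finite (diagram_fillings n C D)"
  unfolding diagram_fillings_def
  by (intro finite_PiE finite_fillings finite_lessThan finite_column[OF assms(1)]
      finite_column[OF assms(2)])

lemma diagram_fillings_nonempty:
  assumes "is_diagram n D" "C \<in> diagrams_below n D"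
  shows "diagram_fillings n C D \<noteq> {}"
proof -
  have "fillings (column C j) (column D j) \<noteq> {}" if "j < n" for j
    using that assms(2) gale_le_iff_fillings[OF finite_column[OF is_diagram_of_below[OF assms(2)]]
      finite_column[OF assms(1)]]
    by (simp add: diagrams_below_def)
  then show ?thesis
    unfolding diagram_fillings_def by (simp add: PiE_eq_empty_iff)
qed

lemma diagram_det_expansion:
  assumes D: "is_diagram n D" and C: "C \<in> diagrams_below n D"
  shows "diagram_det n C D = (\<Sum>G\<in>diagram_fillings n C D.
    Poly_Mapping.single (diagram_filling_monomial n D G) (diagram_filling_sign n C D G))"
proof -
  have C': "is_diagram n C" using C by (rule is_diagram_of_below)
  have "diagram_det n C D = (\<Prod>j<n. \<Sum>g\<in>fillings (column C j) (column D j).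
      Poly_Mapping.single (filling_monomial (column D j) g)
        (of_int (sign (filling_perm (column C j) (column D j) g))))"
    unfolding diagram_det_def
    by (intro prod.cong refl minor_expansion)
      (use C column_subset[OF D] column_subset[OF C'] in \<open>auto simp: diagrams_below_def gale_le_def\<close>)
  also have "\<dots> = (\<Sum>G\<in>diagram_fillings n C D. \<Prod>j<n.
      Poly_Mapping.single (filling_monomial (column D j) (G j))
        (of_int (sign (filling_perm (column C j) (column D j) (G j)))))"
    unfolding diagram_fillings_def
    by (rule prod_sum_PiE) (simp_all add: finite_fillings finite_column[OF D] finite_column[OF C'])
  finally show ?thesis
    by (simp add: prod_single diagram_filling_monomial_def diagram_filling_sign_def)
qed

lemma lookup_diagram_det:
  assumes "is_diagram n D" "C \<in> diagrams_below n D"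
  shows "Poly_Mapping.lookup (diagram_det n C D) m =
    (\<Sum>G | G \<in> diagram_fillings n C D \<and> diagram_filling_monomial n D G = m.
      diagram_filling_sign n C D G)"
proof -
  have "Poly_Mapping.lookup (diagram_det n C D) m = (\<Sum>G\<in>diagram_fillings n C D.
      if diagram_filling_monomial n D G = m then diagram_filling_sign n C D G else 0)"
    unfolding diagram_det_expansion[OF assms] lookup_sum lookup_single when_def ..
  then show ?thesis
    using finite_diagram_fillings[OF is_diagram_of_below[OF assms(2)] assms(1)]
    by (simp only: sum.inter_filter)
qed

lemma keys_diagram_det:
  assumes "is_diagram n D" "C \<in> diagrams_below n D" "m \<in> Poly_Mapping.keys (diagram_det n C D)"
  obtains G where "G \<in> diagram_fillings n C D" "m = diagram_filling_monomial n D G"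
proof -
  have "{G \<in> diagram_fillings n C D. diagram_filling_monomial n D G = m} \<noteq> {}"
  proof
    assume "{G \<in> diagram_fillings n C D. diagram_filling_monomial n D G = m} = {}"
    then show False
      using assms(3) unfolding in_keys_iff lookup_diagram_det[OF assms(1,2)] by (simp only: sum.empty)
  qed
  then show ?thesis using that by blast
qed

text \<open>Each \<open>G j\<close> is a bijection onto column \<open>j\<close> of \<open>C\<close>,
  so the row indices of the factors are the rows of the boxes of \<open>C\<close>, with
  multiplicity.\<close>

lemma row_weight_diagram_filling:
  assumes "G \<in> diagram_fillings n C D"
  shows "row_weight x (diagram_filling_monomial n D G) = diagram_monomial n x C"
proof -
  have "row_weight x (diagram_filling_monomial n D G) = (\<Prod>j<n. \<Prod>s\<in>column D j. x (G j s))"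
    by (simp add: diagram_filling_monomial_def filling_monomial_def row_weight_sum del: One_nat_def)
  also have "\<dots> = (\<Prod>j<n. \<Prod>r\<in>column C j. x r)"
    using assms by (intro prod.cong refl prod.reindex_bij_betw)
      (auto simp: diagram_fillings_def fillings_def)
  finally show ?thesis by (simp add: diagram_monomial_def)
qed

lemma diagram_det_upper:
  assumes D: "is_diagram n D" and C: "C \<in> diagrams_below n D"
  shows "diagram_det n C D \<in> upper_polys n"
  unfolding upper_polys_def
proof (intro CollectI ballI)
  fix m assume "m \<in> Poly_Mapping.keys (diagram_det n C D)"
  then obtain G where G: "G \<in> diagram_fillings n C D" "m = diagram_filling_monomial n D G"
    using keys_diagram_det[OF D C] by blast
  have "Poly_Mapping.keys m \<subseteq> (\<Union>j<n. Poly_Mapping.keys (filling_monomial (column D j) (G j)))"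
    unfolding G diagram_filling_monomial_def by (rule Poly_Mapping.keys_sum)
  also have "\<dots> \<subseteq> (\<Union>j<n. \<Union>s\<in>column D j.
      Poly_Mapping.keys (Poly_Mapping.single (G j s, s) (1::nat)))"
    unfolding filling_monomial_def by (intro UN_mono order_refl Poly_Mapping.keys_sum)
  also have "\<dots> \<subseteq> {(i, j). i \<le> j \<and> j < n}"
    using G column_subset[OF D] by (fastforce simp: diagram_fillings_def fillings_def)
  finally show "Poly_Mapping.keys m \<subseteq> {(i, j). i \<le> j \<and> j < n}" .
qed

lemma flagged_weyl_module_upper:
  assumes "is_diagram n D"
  shows "flagged_weyl_module n D \<subseteq> upper_polys n"
  unfolding flagged_weyl_module_def
  by (rule ypoly.span_minimal) (use diagram_det_upper[OF assms] subspace_upper_polys in auto)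

text \<open>All monomials that occur come from fillings of the same \<open>C\<close>, so the product
  of minors is a weight vector. The identity is stated per coefficient, ready for
  \<open>lookup_borel_act_diag\<close>.\<close>

lemma row_weight_mult_diagram_det:
  assumes D: "is_diagram n D" and C: "C \<in> diagrams_below n D"
  shows "row_weight x m * Poly_Mapping.lookup (diagram_det n C D) m =
    diagram_monomial n x C * Poly_Mapping.lookup (diagram_det n C D) m"
proof (cases "m \<in> Poly_Mapping.keys (diagram_det n C D)")
  case True
  then show ?thesis using keys_diagram_det[OF D C] row_weight_diagram_filling by metis
qed (simp add: in_keys_iff)


subsection \<open>Characters and linear independence\<close>

text \<open>Independence of the indexed family rather than of the set of its values: a vanishing
  product of minors, or the same one for two diagrams, counts as a dependence.\<close>

definition dets_independent :: "nat \<Rightarrow> diagram \<Rightarrow> bool" where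
  "dets_independent n D \<longleftrightarrow>
    (\<forall>a. (\<Sum>C\<in>diagrams_below n D. yscale (a C) (diagram_det n C D)) = 0 \<longrightarrow>
      (\<forall>C\<in>diagrams_below n D. a C = 0))"

text \<open>\<open>E\<close> is the very basis selected by \<open>SOME\<close> in
  \<open>trace_on\<close>, the same for all \<open>T\<close>; a maximal independent subset shows
  that the selection is legitimate.\<close>

lemma weyl_module_basis:
  obtains E where "ypoly.independent E" "ypoly.span E = flagged_weyl_module n D"
    "\<And>T. trace_on (flagged_weyl_module n D) T = (\<Sum>e\<in>E. ypoly.representation E (T e) e)"
proof -
  let ?V = "flagged_weyl_module n D"
  let ?P = "\<lambda>E. ypoly.independent E \<and> ypoly.span E = ?V"
  obtain E where "E \<subseteq> ?V" "ypoly.independent E" "?V \<subseteq> ypoly.span E"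
    by (rule ypoly.maximal_independent_subset)
  moreover from this(1) have "ypoly.span E \<subseteq> ?V"
    unfolding flagged_weyl_module_def by (rule ypoly.span_minimal[OF _ ypoly.subspace_span])
  ultimately have "?P E" by (simp add: subset_antisym)
  then have "?P (SOME E. ?P E)" by (rule someI)
  then show ?thesis by (intro that[of "SOME E. ?P E"]) (simp_all add: trace_on_def Let_def)
qed

text \<open>The products of minors form an eigenbasis of the module, so the trace is the sum of
  their weights.\<close>

lemma dual_weyl_char_of_independent:
  assumes D: "is_diagram n D" and ind: "dets_independent n D" and x: "\<forall>i<n. x i \<noteq> 0"
  shows "dual_weyl_char n D x = (\<Sum>C\<in>diagrams_below n D. diagram_monomial n x C)"
proof -
  let ?I = "diagrams_below n D" and ?v = "\<lambda>C. diagram_det n C D"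
  let ?F = "?v ` ?I" and ?T = "\<lambda>f. borel_act n f (mat_diag n (\<lambda>i. inverse (x i)))"
  have inj: "inj_on ?v ?I" and F: "ypoly.independent ?F"
    using ypoly.independent_family[OF finite_diagrams_below, where v = ?v] ind
    unfolding dets_independent_def by blast+
  \<comment> \<open>The eigenvalue is attached to the vector; this is unambiguous because
    \<open>inj\<close> makes \<open>C\<close> recoverable from its product of minors.\<close>
  define l where "l = (\<lambda>f. diagram_monomial n x (inv_into ?I ?v f))"
  have l: "l (?v C) = diagram_monomial n x C" if "C \<in> ?I" for C
    using inv_into_f_f[OF inj that] by (simp add: l_def)
  obtain E where E: "ypoly.independent E" "ypoly.span E = flagged_weyl_module n D"
    and tr: "\<And>T. trace_on (flagged_weyl_module n D) T = (\<Sum>e\<in>E. ypoly.representation E (T e) e)"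
    using weyl_module_basis by blast
  have span: "ypoly.span E = ypoly.span ?F" by (simp add: E flagged_weyl_module_def)
  have fin: "finite ?F" using finite_diagrams_below by simp
  have "dual_weyl_char n D x = (\<Sum>e\<in>E. ypoly.representation E (?T e) e)"
    by (simp add: dual_weyl_char_def weyl_char_def tr)
  also have "\<dots> = (\<Sum>f\<in>?F. l f)"
  proof (rule ypoly.sum_diagonal_representation[OF E(1) F fin span])
    fix v assume v: "v \<in> ypoly.span ?F"
    let ?r = "ypoly.representation ?F v"
    show "?T v = (\<Sum>f\<in>?F. yscale (?r f * l f) f)"
    proof (rule poly_mapping_eqI)
      fix m
      have eq: "row_weight x m * Poly_Mapping.lookup f m = l f * Poly_Mapping.lookup f m"
        if f: "f \<in> ?F" for f
      proof -
        obtain C where "C \<in> ?I" "f = ?v C" using f by blast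
        then show ?thesis by (simp only: l row_weight_mult_diagram_det[OF D])
      qed
      have "v = (\<Sum>f\<in>?F. yscale (?r f) f)"
        by (rule ypoly.sum_representation_eq[OF F v fin order_refl, symmetric])
      then have "Poly_Mapping.lookup v m = (\<Sum>f\<in>?F. ?r f * Poly_Mapping.lookup f m)"
        using lookup_sum[of "\<lambda>f. yscale (?r f) f" ?F m] by simp
      moreover have "v \<in> upper_polys n"
        using v flagged_weyl_module_upper[OF D] by (auto simp: flagged_weyl_module_def)
      ultimately have "Poly_Mapping.lookup (?T v) m =
          (\<Sum>f\<in>?F. ?r f * (row_weight x m * Poly_Mapping.lookup f m))"
        by (simp add: lookup_borel_act_diag[OF x] sum_distrib_left mult_ac)
      also have "\<dots> = Poly_Mapping.lookup (\<Sum>f\<in>?F. yscale (?r f * l f) f) m"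
        unfolding lookup_sum lookup_yscale by (intro sum.cong refl) (simp add: eq)
      finally show "Poly_Mapping.lookup (?T v) m =
          Poly_Mapping.lookup (\<Sum>f\<in>?F. yscale (?r f * l f) f) m" .
    qed
  qed
  also have "\<dots> = (\<Sum>C\<in>?I. diagram_monomial n x C)"
    by (simp add: sum.reindex[OF inj] l)
  finally show ?thesis .
qed

lemma independent_of_dual_weyl_char:
  assumes D: "is_diagram n D"
    and char: "dual_weyl_char n D (\<lambda>_. 1) = (\<Sum>C\<in>diagrams_below n D. diagram_monomial n (\<lambda>_. 1) C)"
  shows "dets_independent n D"
proof -
  let ?I = "diagrams_below n D" and ?v = "\<lambda>C. diagram_det n C D"
  let ?T = "\<lambda>f. borel_act n f (mat_diag n (\<lambda>i. inverse 1))"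
  obtain E where E: "ypoly.independent E" "ypoly.span E = flagged_weyl_module n D"
    and tr: "\<And>T. trace_on (flagged_weyl_module n D) T = (\<Sum>e\<in>E. ypoly.representation E (T e) e)"
    using weyl_module_basis by blast
  have "?T e = e" if e: "e \<in> E" for e
  proof (rule poly_mapping_eqI)
    fix m
    have "e \<in> upper_polys n"
      using e E flagged_weyl_module_upper[OF D] ypoly.span_base by blast
    then show "Poly_Mapping.lookup (?T e) m = Poly_Mapping.lookup e m"
      using lookup_borel_act_diag[of n "\<lambda>_. 1" e m] by (simp add: row_weight_def)
  qed
  then have "dual_weyl_char n D (\<lambda>_. 1) = (\<Sum>e\<in>E. 1)"
    unfolding dual_weyl_char_def weyl_char_def tr
    by (intro sum.cong refl) (simp add: ypoly.representation_basis[OF E(1)])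
  \<comment> \<open>At 1 every diagram monomial is 1, so the equality of characters compares two
    cardinalities.\<close>
  with char have card: "card E = card ?I"
    by (simp add: diagram_monomial_def)
  show ?thesis
    unfolding dets_independent_def
  proof (intro allI impI ballI)
    fix a C assume sum: "(\<Sum>C\<in>?I. yscale (a C) (?v C)) = 0" and C: "C \<in> ?I"
    have span: "ypoly.span E = ypoly.span (?v ` ?I)" by (simp add: E flagged_weyl_module_def)
    have "E \<subseteq> ypoly.span (?v ` ?I)" "?v ` ?I \<subseteq> ypoly.span E"
      unfolding span[symmetric] by (rule ypoly.span_superset) (unfold span, rule ypoly.span_superset)
    then show "a C = 0"
      by (rule ypoly.family_independent_of_card_basis
          [OF finite_diagrams_below E(1) _ _ card sum C])
  qed
qed


subsection \<open>Independence\<close>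

lemma fillings_swap:
  assumes g: "g \<in> fillings R S" and st: "s \<in> S" "t \<in> S" "g s \<le> t" "g t \<le> s"
  shows "g(s := g t, t := g s) \<in> fillings R S"
proof -
  let ?g = "g(s := g t, t := g s)"
  have "bij_betw (Transposition.transpose s t) S S"
    by (rule permutes_imp_bij) (use st in \<open>simp add: permutes_swap_id\<close>)
  then have "bij_betw (g \<circ> Transposition.transpose s t) S R"
    using g by (auto simp: fillings_def intro: bij_betw_trans)
  moreover have "g \<circ> Transposition.transpose s t = ?g"
    by (auto simp: fun_eq_iff Transposition.transpose_def)
  ultimately show ?thesis
    using g st by (auto simp: fillings_def PiE_def extensional_def)
qed

text \<open>The sum of \<open>r * s\<close> over the factors \<open>y\<^sub>r\<^sub>s\<close>. It
  depends on the monomial alone, so fillings of different diagrams with equal monomials have equal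
  energy.\<close>

definition energy :: "nat \<Rightarrow> ((nat \<times> nat) \<Rightarrow>\<^sub>0 nat) \<Rightarrow> nat" where
  "energy n m = (\<Sum>v\<in>{..<n} \<times> {..<n}. Poly_Mapping.lookup m v * (fst v * snd v))"

lemma energy_sum: "energy n (\<Sum>i\<in>I. m i) = (\<Sum>i\<in>I. energy n (m i))"
  by (induction I rule: infinite_finite_induct)
    (simp_all add: energy_def lookup_add algebra_simps sum.distrib)

lemma energy_single:
  assumes "r < n" "s < n"
  shows "energy n (Poly_Mapping.single (r, s) 1) = r * s"
proof -
  have "energy n (Poly_Mapping.single (r, s) 1) =
      (\<Sum>v\<in>{..<n} \<times> {..<n}. if v = (r, s) then r * s else 0)"
    unfolding energy_def by (intro sum.cong refl) (auto simp: lookup_single when_def)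
  then show ?thesis using assms by simp
qed

lemma energy_diagram_filling:
  assumes D: "is_diagram n D" and G: "G \<in> diagram_fillings n C D"
  shows "energy n (diagram_filling_monomial n D G) = (\<Sum>j<n. \<Sum>s\<in>column D j. G j s * s)"
  unfolding diagram_filling_monomial_def filling_monomial_def energy_sum
proof (intro sum.cong refl energy_single)
  fix j s assume j: "j \<in> {..<n}" and s: "s \<in> column D j"
  then show "s < n" using column_subset[OF D] by auto
  moreover have "G j s \<le> s" using G j s by (auto simp: diagram_fillings_def fillings_def)
  ultimately show "G j s < n" by simp
qed

lemma keys_diagram_filling_monomial:
  assumes D: "is_diagram n D"
  shows "(r, s) \<in> Poly_Mapping.keys (diagram_filling_monomial n D G) \<longleftrightarrow>
    (\<exists>j<n. s \<in> column D j \<and> G j s = r)"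
proof -
  have "Poly_Mapping.lookup (diagram_filling_monomial n D G) (r, s) =
      (\<Sum>j<n. \<Sum>t\<in>column D j. if (G j t, t) = (r, s) then 1 else 0)"
    unfolding diagram_filling_monomial_def filling_monomial_def lookup_sum lookup_single when_def ..
  then show ?thesis
    using finite_column[OF D] by (auto simp: in_keys_iff)
qed

text \<open>Suppose \<open>r = G j s\<close> lies in column \<open>j\<close> and
  \<open>r < s\<close>. Then \<open>q = G j r < r\<close> by injectivity, and sending
  \<open>s\<close> to \<open>q\<close> and \<open>r\<close> to itself lowers the energy by
  \<open>(s - r) * (r - q) > 0\<close>.\<close>

lemma energy_minimal_filling:
  assumes D: "is_diagram n D" and G: "G \<in> diagram_fillings n C D"
    and min: "\<And>G'. G' \<in> diagram_fillings n C D \<Longrightarrow>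
      energy n (diagram_filling_monomial n D G) \<le> energy n (diagram_filling_monomial n D G')"
    and j: "j < n" and s: "s \<in> column D j"
  shows "G j s = s \<or> G j s \<notin> column D j"
proof (rule ccontr)
  assume "\<not> (G j s = s \<or> G j s \<notin> column D j)"
  then have ne: "G j s \<noteq> s" and r: "G j s \<in> column D j" by auto
  let ?S = "column D j" and ?r = "G j s"
  let ?q = "G j ?r"
  have g: "G j \<in> fillings (column C j) ?S" using G j by (auto simp: diagram_fillings_def)
  then have inj: "inj_on (G j) ?S" and le: "\<And>t. t \<in> ?S \<Longrightarrow> G j t \<le> t"
    by (auto simp: fillings_def bij_betw_def)
  have rs: "?r < s" using le[OF s] ne by simp
  have "?q \<noteq> ?r" using inj_onD[OF inj _ r s] ne by auto
  then have qr: "?q < ?r" using le[OF r] by simp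
  let ?g = "(G j)(s := ?q, ?r := ?r)"
  have g': "?g \<in> fillings (column C j) ?S"
    using fillings_swap[OF g s r] qr rs by simp
  let ?G = "G(j := ?g)"
  have G': "?G \<in> diagram_fillings n C D"
    using G g' j by (auto simp: diagram_fillings_def PiE_def extensional_def)
  have fin: "finite ?S" using D by (rule finite_column)
  have split: "(\<Sum>t\<in>?S. f t) = f s + (f ?r + (\<Sum>t\<in>?S - {s} - {?r}. f t))" for f :: "nat \<Rightarrow> nat"
    using fin s r ne by (simp add: sum.remove[of ?S s] sum.remove[of "?S - {s}" ?r])
  have splitj: "(\<Sum>k<n. f k) = f j + (\<Sum>k\<in>{..<n} - {j}. f k)" for f :: "nat \<Rightarrow> nat"
    using j by (simp add: sum.remove)
  \<comment> \<open>The differences \<open>r - q\<close> and \<open>s - r\<close> are named as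
    successors to avoid truncated subtraction.\<close>
  obtain d where d: "?r = ?q + Suc d" using less_imp_Suc_add[OF qr] by auto
  obtain e where e: "s = ?r + Suc e" using less_imp_Suc_add[OF rs] by auto
  have arith: "q * (r + Suc e) + r * r < r * (r + Suc e) + q * r" if "r = q + Suc d" for q r
    unfolding that by (simp add: algebra_simps)
  have "?q * s + ?r * ?r < ?r * s + ?q * ?r"
    using arith[OF d] by (subst (1 2) e) (simp only:)
  moreover have "(\<Sum>t\<in>?S - {s} - {?r}. ?g t * t) = (\<Sum>t\<in>?S - {s} - {?r}. G j t * t)"
    by (rule sum.cong) auto
  ultimately have "(\<Sum>t\<in>?S. ?g t * t) < (\<Sum>t\<in>?S. G j t * t)"
    unfolding split using ne by simp
  moreover have "(\<Sum>k\<in>{..<n} - {j}. \<Sum>t\<in>column D k. ?G k t * t) =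
      (\<Sum>k\<in>{..<n} - {j}. \<Sum>t\<in>column D k. G k t * t)"
    by (intro sum.cong) auto
  ultimately have "(\<Sum>k<n. \<Sum>t\<in>column D k. ?G k t * t) < (\<Sum>k<n. \<Sum>t\<in>column D k. G k t * t)"
    unfolding splitj by simp
  then show False
    using min[OF G'] unfolding energy_diagram_filling[OF D G] energy_diagram_filling[OF D G'] by simp
qed

section \<open>Fillings determined by their monomial\<close>

definition column_avoiding :: "nat \<Rightarrow> diagram \<Rightarrow> bool" where
  "column_avoiding n D \<longleftrightarrow> (\<forall>r s j k. r < s \<longrightarrow> j < n \<longrightarrow> k < n \<longrightarrow> j \<noteq> k \<longrightarrow>
    s \<in> column D j \<longrightarrow> s \<in> column D k \<longrightarrow> r \<in> column D j \<or> r \<in> column D k)"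

text \<open>With \<open>r = G j s\<close>, the factor \<open>y\<^sub>r\<^sub>s\<close> must also
  arise from some column \<open>k\<close> under \<open>G'\<close>. Both columns contain
  \<open>s\<close> and, by \<open>good\<close> and \<open>good'\<close>, omit \<open>r\<close>;
  avoidance forces \<open>j = k\<close>.\<close>

lemma minimal_filling_eq_of_monomial:
  assumes D: "is_diagram n D" and avoid: "column_avoiding n D"
    and G: "G \<in> diagram_fillings n C D"
    and good: "\<And>j s. j < n \<Longrightarrow> s \<in> column D j \<Longrightarrow> G j s = s \<or> G j s \<notin> column D j"
    and good': "\<And>j s. j < n \<Longrightarrow> s \<in> column D j \<Longrightarrow> G' j s = s \<or> G' j s \<notin> column D j"
    and eq: "diagram_filling_monomial n D G = diagram_filling_monomial n D G'"
    and j: "j < n" and s: "s \<in> column D j" and ne: "G j s \<noteq> s"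
  shows "G' j s = G j s"
proof -
  have le: "G j s < s"
    using G j s ne by (fastforce simp: diagram_fillings_def fillings_def)
  have "(G j s, s) \<in> Poly_Mapping.keys (diagram_filling_monomial n D G)"
    using j s by (auto simp: keys_diagram_filling_monomial[OF D])
  then obtain k where k: "k < n" "s \<in> column D k" "G' k s = G j s"
    unfolding eq by (auto simp: keys_diagram_filling_monomial[OF D])
  have "G j s \<notin> column D j" "G j s \<notin> column D k"
    using good[OF j s] good'[OF k(1,2)] k(3) ne by auto
  then have "j = k" using avoid le j k s unfolding column_avoiding_def by blast
  then show ?thesis using k by simp
qed

lemma diagram_filling_determines:
  assumes C: "is_diagram n C" "is_diagram n C'"
    and G: "G \<in> diagram_fillings n C D" "G' \<in> diagram_fillings n C' D"
    and eq: "\<And>j s. j < n \<Longrightarrow> s \<in> column D j \<Longrightarrow> G j s = G' j s"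
  shows "C = C'" "G = G'"
proof -
  have f: "G j \<in> fillings (column C j) (column D j)" "G' j \<in> fillings (column C' j) (column D j)"
    if "j < n" for j
    using G[unfolded diagram_fillings_def, THEN PiE_mem, of j] that by simp_all
  have Gj: "G j = G' j" if "j < n" for j
  proof (rule extensionalityI)
    show "G j \<in> extensional (column D j)" "G' j \<in> extensional (column D j)"
      using f[OF that] by (simp_all add: fillings_def PiE_def)
  qed (rule eq[OF that])
  then show "G = G'"
    using G Gj by (auto simp: diagram_fillings_def PiE_def intro: extensionalityI)
  show "C = C'"
  proof (rule diagram_eqI[OF C])
    fix j assume j: "j < n"
    have "column C j = G j ` column D j" "column C' j = G' j ` column D j"
      using f[OF j] by (auto simp: fillings_def bij_betw_def)
    then show "column C j = column C' j" using Gj[OF j] by simp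
  qed
qed

lemma dets_independent_of_avoiding:
  assumes D: "is_diagram n D" and avoid: "column_avoiding n D"
  shows "dets_independent n D"
  unfolding dets_independent_def
proof (intro allI impI, rule ccontr)
  fix a
  let ?I = "diagrams_below n D" and ?m = "diagram_filling_monomial n D"
  assume sum: "(\<Sum>C\<in>?I. yscale (a C) (diagram_det n C D)) = 0"
    and "\<not> (\<forall>C\<in>?I. a C = 0)"
  then obtain C0 where C0: "C0 \<in> ?I" "a C0 \<noteq> 0" by blast
  \<comment> \<open>The minimum is taken over the fillings of all diagrams with nonzero coefficient
    at once, so that it can be compared across diagrams.\<close>
  let ?P = "\<lambda>(C, G). C \<in> ?I \<and> a C \<noteq> 0 \<and> G \<in> diagram_fillings n C D"
  obtain G0 where "G0 \<in> diagram_fillings n C0 D"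
    using diagram_fillings_nonempty[OF D C0(1)] by blast
  with C0 have "?P (C0, G0)" by simp
  then obtain p where p: "?P p" and least: "\<And>q. ?P q \<Longrightarrow> energy n (?m (snd p)) \<le> energy n (?m (snd q))"
    using ex_has_least_nat[of ?P "(C0, G0)" "\<lambda>q. energy n (?m (snd q))"] by blast
  obtain C G where CG: "p = (C, G)" by fastforce
  have C: "C \<in> ?I" "a C \<noteq> 0" and G: "G \<in> diagram_fillings n C D"
    using p unfolding CG by auto
  have min: "energy n (?m G) \<le> energy n (?m G')"
    if "C' \<in> ?I" "a C' \<noteq> 0" "G' \<in> diagram_fillings n C' D" for C' G'
    using least[of "(C', G')"] that unfolding CG by simp
  \<comment> \<open>Equal monomials have equal energy, so every such filling is itself minimal for
    its own diagram.\<close>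
  have good: "G' j s = s \<or> G' j s \<notin> column D j"
    if "C' \<in> ?I" "a C' \<noteq> 0" "G' \<in> diagram_fillings n C' D" "?m G' = ?m G"
      "j < n" "s \<in> column D j" for C' G' j s
    by (rule energy_minimal_filling[OF D that(3) _ that(5,6)]) (use min that in simp)
  have unique: "C' = C \<and> G' = G"
    if C': "C' \<in> ?I" "a C' \<noteq> 0" "G' \<in> diagram_fillings n C' D" "?m G' = ?m G" for C' G'
  proof -
    \<comment> \<open>If either filling moves \<open>s\<close>, the other one agrees with it there,
      by the same lemma with the roles exchanged; otherwise both fix \<open>s\<close>.\<close>
    have "G j s = G' j s" if js: "j < n" "s \<in> column D j" for j s
    proof (cases "G j s = s")
      case False
      show ?thesis
        by (rule minimal_filling_eq_of_monomial[OF D avoid G good[OF C G refl] good[OF C']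
              \<open>?m G' = ?m G\<close>[symmetric] js False, symmetric])
    next
      case True
      show ?thesis
      proof (cases "G' j s = s")
        case False
        show ?thesis
          by (rule minimal_filling_eq_of_monomial[OF D avoid \<open>G' \<in> _\<close> good[OF C'] good[OF C G refl]
                \<open>?m G' = ?m G\<close> js False])
      qed (simp add: True)
    qed
    from diagram_filling_determines[OF is_diagram_of_below[OF C(1)]
        is_diagram_of_below[OF \<open>C' \<in> ?I\<close>] G \<open>G' \<in> _\<close> this]
    show ?thesis by simp
  qed
  \<comment> \<open>The coefficient of the minimal monomial is compared on both sides; by
    \<open>unique\<close> only the pair \<open>(C, G)\<close> contributes.\<close>
  have "0 = (\<Sum>C'\<in>?I. a C' * Poly_Mapping.lookup (diagram_det n C' D) (?m G))"
    using arg_cong[OF sum, of "\<lambda>f. Poly_Mapping.lookup f (?m G)"] by (simp add: lookup_sum)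
  also have "\<dots> = (\<Sum>C'\<in>?I. if C' = C then a C * diagram_filling_sign n C D G else 0)"
  proof (intro sum.cong refl)
    fix C' assume C': "C' \<in> ?I"
    let ?X = "{G'. G' \<in> diagram_fillings n C' D \<and> ?m G' = ?m G}"
    have lk: "Poly_Mapping.lookup (diagram_det n C' D) (?m G) =
        (\<Sum>G'\<in>?X. diagram_filling_sign n C' D G')"
      by (rule lookup_diagram_det[OF D C'])
    show "a C' * Poly_Mapping.lookup (diagram_det n C' D) (?m G) =
      (if C' = C then a C * diagram_filling_sign n C D G else 0)"
    proof (cases "a C' = 0")
      case True
      then show ?thesis using C by auto
    next
      case False
      show ?thesis
      proof (cases "C' = C")
        case True
        then have "?X = {G}" using unique[OF C] G by blast
        then show ?thesis using True lk by simp
      next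
        case ne: False
        then have "?X = {}" using unique[OF C' False] by blast
        then show ?thesis using ne lk by (simp only: sum.empty) simp
      qed
    qed
  qed
  also have "\<dots> = a C * diagram_filling_sign n C D G"
    using C finite_diagrams_below by simp
  finally show False using C diagram_filling_sign_nonzero by simp
qed


subsection \<open>A linear relation between products of two minors\<close>

lemma minus_self_ypoly:
  fixes f :: ypoly
  assumes "f = - f"
  shows "f = 0"
proof (rule poly_mapping_eqI)
  fix m
  have "Poly_Mapping.lookup f m = - Poly_Mapping.lookup f m"
    by (subst assms) simp
  then show "Poly_Mapping.lookup f m = Poly_Mapping.lookup 0 m" by simp
qed

section \<open>Row sets that vary only inside an interval\<close>

lemma card_replace_in:
  assumes "finite A" "finite P" "P \<subseteq> I" "card P = card (A \<inter> I)"
  shows "card ((A - I) \<union> P) = card A"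
proof -
  have "card ((A - I) \<union> P) = card (A - I) + card (A \<inter> I)"
    unfolding assms(4)[symmetric] by (rule card_Un_disjoint) (use assms in auto)
  also have "\<dots> = card ((A - I) \<union> (A \<inter> I))"
    by (rule card_Un_disjoint[symmetric]) (use assms in auto)
  also have "(A - I) \<union> (A \<inter> I) = A" by blast
  finally show ?thesis .
qed

text \<open>Only rows in \<open>P\<close> survive in the Laplace expansion along \<open>q\<close>: a
  row after \<open>q\<close> has a zero entry there, and a row before \<open>p\<close> has a
  vanishing complementary minor. Later exchanges therefore stay inside the interval.\<close>

lemma minor_expand_column_interval:
  fixes p q :: nat
  assumes A: "A \<subseteq> {..<n}" and q: "q \<in> A" "p \<le> q"
    and P: "P \<subseteq> {p..q}" "card P = card (A \<inter> {p..q})"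
  defines "R \<equiv> (A - {p..q}) \<union> P"
  shows "minor n R A = (\<Sum>a\<in>P. (-1) ^ (position R a + position A q) *
    (Y_mat n $$ (a, q) * minor n (R - {a}) (A - {q})))"
proof -
  have finA: "finite A" and finP: "finite P"
    using A P(1) finite_subset by (blast intro: finite_lessThan, blast)
  have qn: "q < n" using A q by auto
  have R: "R \<subseteq> {..<n}" using A P(1) qn by (force simp: R_def)
  have finR: "finite R" using finA finP by (simp add: R_def)
  have card: "card R = card A"
    unfolding R_def by (rule card_replace_in[OF finA finP P])
  have zero: "Y_mat n $$ (a, q) * minor n (R - {a}) (A - {q}) = 0" if a: "a \<in> R - P" for a
  proof -
    have aA: "a \<in> A" "a < p \<or> q < a" using a P(1) by (auto simp: R_def)
    show ?thesis
    proof (cases "q < a")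
      case True
      moreover have "a < n" using A aA by auto
      ultimately have "Y_mat n $$ (a, q) = 0" using qn by (simp add: Y_mat_def)
      then show ?thesis by simp
    next
      case False
      then have ap: "a < p" using aA by simp
      \<comment> \<open>removing \<open>a\<close> leaves too few rows below \<open>p\<close>\<close>
      have "fillings (R - {a}) (A - {q}) = {}"
      proof (rule ccontr)
        assume "fillings (R - {a}) (A - {q}) \<noteq> {}"
        then obtain g where "g \<in> fillings (R - {a}) (A - {q})" by blast
        then have "card {s \<in> A - {q}. s < p} \<le> card {r \<in> R - {a}. r < p}"
          using finR by (intro card_below_le_of_filling) simp
        moreover have "{s \<in> A - {q}. s < p} = insert a {r \<in> R - {a}. r < p}"
          using aA ap q P(1) by (auto simp: R_def)
        ultimately show False using finR by simp
      qed
      moreover have "card (R - {a}) = card (A - {q})"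
        using card a q finA finR by (simp add: card_Diff_singleton)
      ultimately have "minor n (R - {a}) (A - {q}) = 0"
        using R A by (intro minor_eq_0) auto
      then show ?thesis by simp
    qed
  qed
  have "minor n R A = (\<Sum>a\<in>R. (-1) ^ (position R a + position A q) *
      (Y_mat n $$ (a, q) * minor n (R - {a}) (A - {q})))"
    by (rule minor_expand_column[OF R A card q(1)])
  also have "\<dots> = (\<Sum>a\<in>P. (-1) ^ (position R a + position A q) *
      (Y_mat n $$ (a, q) * minor n (R - {a}) (A - {q})))"
    by (rule sum.mono_neutral_right[OF finR]) (auto simp: R_def zero[unfolded R_def])
  finally show ?thesis .
qed

lemma position_add_interval:
  assumes "finite K" "a \<le> b"
  shows "position K b = position K a + card (K \<inter> {a..<b})"
proof -
  have "{x \<in> K. x < b} = {x \<in> K. x < a} \<union> (K \<inter> {a..<b})" using assms by auto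
  then show ?thesis
    unfolding position_def using assms by (simp add: card_Un_disjoint disjoint_iff)
qed

text \<open>Each row strictly between \<open>a\<close> and \<open>b\<close> lies in exactly one of
  \<open>K\<close> and \<open>L\<close>, so passing from \<open>a\<close> to \<open>b\<close> raises
  the sum of the two positions by \<open>b - a - 1\<close>.\<close>

lemma position_swap_parity_less:
  assumes "finite K" "finite L" "a < b"
    and "K \<inter> L \<inter> {a..<b} = {}" "(K \<union> L) \<inter> {a..<b} = {a<..<b}"
  shows "position K b + position L b + Suc a = position K a + position L a + b"
proof -
  have "card (K \<inter> {a..<b}) + card (L \<inter> {a..<b}) = card ((K \<inter> {a..<b}) \<union> (L \<inter> {a..<b}))"
    by (rule card_Un_disjoint[symmetric]) (use assms in auto)
  also have "(K \<inter> {a..<b}) \<union> (L \<inter> {a..<b}) = {a<..<b}" using assms(5) by blast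
  finally have "card (K \<inter> {a..<b}) + card (L \<inter> {a..<b}) = b - Suc a" by simp
  then show ?thesis
    using position_add_interval[of K a b] position_add_interval[of L a b] assms by simp
qed

text \<open>Inside the interval, \<open>A\<close> and \<open>B\<close> together miss only
  \<open>p\<close> and share only \<open>q\<close>, so their sizes there add up to that of the
  interval.\<close>

lemma card_complement_in_interval:
  fixes p q :: nat
  assumes pq: "p < q" and p: "p \<notin> A" "p \<notin> B" and q: "q \<in> A" "q \<in> B"
    and between: "\<And>i. p < i \<Longrightarrow> i < q \<Longrightarrow> i \<in> A \<longleftrightarrow> i \<notin> B"
    and P: "P \<subseteq> {p..q}" "card P = card (A \<inter> {p..q})"
  shows "card ({p..q} - P) = card (B \<inter> {p..q})"
proof -
  let ?I = "{p..q}"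
  have "card (A \<inter> ?I) + card (B \<inter> ?I) = card ((A \<inter> ?I) \<union> (B \<inter> ?I)) + card ((A \<inter> ?I) \<inter> (B \<inter> ?I))"
    by (rule card_Un_Int) auto
  also have "(A \<inter> ?I) \<union> (B \<inter> ?I) = ?I - {p}"
    using p q between pq by (auto simp: le_less)
  also have "(A \<inter> ?I) \<inter> (B \<inter> ?I) = {q}"
    using p q between pq by (auto simp: le_less)
  also have "card (?I - {p}) + card {q} = card ?I"
    using pq by (simp add: card_Diff_singleton)
  finally show ?thesis
    using P finite_subset[OF P(1)] by (simp add: card_Diff_subset)
qed

text \<open>
  Both minors are expanded along the common column \<open>q\<close>. The resulting terms, indexed by a set \<open>P\<close> and
  rows \<open>a \<in> P\<close>, \<open>b \<notin> P\<close>, cancel in pairs by exchanging \<open>a\<close> and \<open>b\<close>.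
\<close>

lemma two_minors_relation:
  fixes p q :: nat
  assumes A: "A \<subseteq> {..<n}" and B: "B \<subseteq> {..<n}" and pq: "p < q"
    and p: "p \<notin> A" "p \<notin> B" and q: "q \<in> A" "q \<in> B"
    and between: "\<And>i. p < i \<Longrightarrow> i < q \<Longrightarrow> i \<in> A \<longleftrightarrow> i \<notin> B"
  defines "I \<equiv> {p..q}"
  defines "T \<equiv> {P. P \<subseteq> I \<and> card P = card (A \<inter> I)}"
  defines "RA \<equiv> \<lambda>P. (A - I) \<union> P" and "RB \<equiv> \<lambda>P. (B - I) \<union> (I - P)"
  shows "(\<Sum>P\<in>T. (-1) ^ (\<Sum>P) * (minor n (RA P) A * minor n (RB P) B)) = 0"
proof -
  have finA: "finite A" and finB: "finite B" using A B finite_subset by auto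
  have finI: "finite I" by (simp add: I_def)
  have finT: "finite T" using finI by (simp add: T_def)
  have fin: "finite P" if "P \<in> T" for P using that finI finite_subset by (auto simp: T_def)
  have cardB: "card (I - P) = card (B \<inter> I)" if "P \<in> T" for P
    unfolding I_def by (rule card_complement_in_interval[OF pq p q between])
      (use that in \<open>auto simp: T_def I_def\<close>)
  define MA where "MA K = minor n K (A - {q})" for K
  define MB where "MB K = minor n K (B - {q})" for K
  \<comment> \<open>All factors after the first power of -1 are unchanged when \<open>a\<close> and
    \<open>b\<close> are exchanged between the two row sets, so only the parity of that exponent
    matters.\<close>
  define F where "F = (\<lambda>(P, a, b). (-1) ^ (position (RA P) a + position (RB P) b + \<Sum>P) *
    ((-1) ^ (position A q + position B q) *
    (Y_mat n $$ (a, q) * Y_mat n $$ (b, q) * (MA (RA P - {a}) * MB (RB P - {b})))))"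
  define Z where "Z = (SIGMA P:T. P \<times> (I - P))"
  \<comment> \<open>The sign-reversing involution: row \<open>a\<close> moves to the second minor
    and row \<open>b\<close> to the first.\<close>
  define \<phi> where "\<phi> = (\<lambda>(P, a :: nat, b :: nat). (insert b (P - {a}), b, a))"
  have "(\<Sum>P\<in>T. (-1) ^ (\<Sum>P) * (minor n (RA P) A * minor n (RB P) B)) =
      (\<Sum>P\<in>T. \<Sum>(a, b)\<in>P \<times> (I - P). F (P, a, b))"
  proof (rule sum.cong[OF refl])
    fix P assume P: "P \<in> T"
    have eA: "minor n (RA P) A = (\<Sum>a\<in>P. (-1) ^ (position (RA P) a + position A q) *
        (Y_mat n $$ (a, q) * MA (RA P - {a})))"
      unfolding RA_def I_def MA_def
      by (rule minor_expand_column_interval[OF A q(1)]) (use pq P in \<open>auto simp: T_def I_def\<close>)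
    have eB: "minor n (RB P) B = (\<Sum>b\<in>I - P. (-1) ^ (position (RB P) b + position B q) *
        (Y_mat n $$ (b, q) * MB (RB P - {b})))"
      unfolding RB_def I_def MB_def
      by (rule minor_expand_column_interval[OF B q(2)])
        (use pq cardB[OF P] in \<open>auto simp: I_def\<close>)
    show "(-1) ^ (\<Sum>P) * (minor n (RA P) A * minor n (RB P) B) =
        (\<Sum>(a, b)\<in>P \<times> (I - P). F (P, a, b))"
      unfolding eA eB
      by (subst sum_product, unfold sum_distrib_left sum.cartesian_product F_def,
          intro sum.cong refl) (simp add: power_add mult_ac split: prod.splits)
  qed
  also have "\<dots> = (\<Sum>z\<in>Z. F z)"
    unfolding Z_def by (subst sum.Sigma) (use finT fin finI in \<open>auto simp: case_prod_unfold\<close>)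
  finally have total: "(\<Sum>P\<in>T. (-1) ^ (\<Sum>P) * (minor n (RA P) A * minor n (RB P) B)) =
    (\<Sum>z\<in>Z. F z)" .
  have \<phi>: "\<phi> z \<in> Z \<and> \<phi> (\<phi> z) = z \<and> F (\<phi> z) = - F z" if z: "z \<in> Z" for z
  proof -
    obtain P a b where zP: "z = (P, a, b)" and P: "P \<in> T" and a: "a \<in> P" and b: "b \<in> I" "b \<notin> P"
      using z unfolding Z_def by blast
    have aI: "a \<in> I" using P a by (auto simp: T_def)
    have PI: "P \<subseteq> I" using P by (auto simp: T_def)
    have ab: "a \<noteq> b" using a b by auto
    let ?P = "insert b (P - {a})"
    have "card ?P = card P" using fin[OF P] a b ab
      by (simp add: card_Diff_singleton) (metis One_nat_def Suc_pred card_gt_0_iff empty_iff)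
    then have P': "?P \<in> T" using P b by (auto simp: T_def)
    have 1: "\<phi> z \<in> Z" using P' aI ab a by (auto simp: \<phi>_def zP Z_def)
    have 2: "\<phi> (\<phi> z) = z" using a b by (auto simp: \<phi>_def zP)
    let ?K = "RA P - {a}" and ?L = "RB P - {b}"
    have K: "RA ?P - {b} = ?K" using a b aI by (auto simp: RA_def)
    have L: "RB ?P - {a} = ?L" using a b aI by (auto simp: RB_def)
    have mem: "a \<in> RA P" "b \<in> RB P" "b \<in> RA ?P" "a \<in> RB ?P"
      using a b aI ab by (auto simp: RA_def RB_def)
    have finR: "finite (RA Q)" "finite (RB Q)" if "Q \<in> T" for Q
      using finA finB finI fin[OF that] by (auto simp: RA_def RB_def)
    have pos: "position (RA P) a = position ?K a" "position (RB P) b = position ?L b"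
      "position (RA ?P) b = position ?K b" "position (RB ?P) a = position ?L a"
      using position_remove[OF finR(1)[OF P] mem(1), of a] position_remove[OF finR(2)[OF P] mem(2), of b]
        position_remove[OF finR(1)[OF P'] mem(3), of b] position_remove[OF finR(2)[OF P'] mem(4), of a]
      unfolding K L by simp_all
    have S: "\<Sum>P + b = \<Sum>?P + a"
      using fin[OF P] a b by (simp add: sum.remove[of P a])
    have KL: "?K \<inter> ?L \<inter> I = {}" "(?K \<union> ?L) \<inter> I = I - {a, b}"
      using PI a b aI by (auto simp: RA_def RB_def)
    have finKL: "finite ?K" "finite ?L" using finR[OF P] by auto
    \<comment> \<open>Stated for an ordered pair \<open>x < y\<close>, to cover both orders of
      \<open>a\<close> and \<open>b\<close>.\<close>
    have swap: "position ?K y + position ?L y + Suc x = position ?K x + position ?L x + y"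
      if "x < y" "{x, y} = {a, b}" for x y
    proof (rule position_swap_parity_less[OF finKL that(1)])
      have sub: "{x..<y} \<subseteq> I" using that aI b unfolding I_def by (auto simp: doubleton_eq_iff)
      then show "?K \<inter> ?L \<inter> {x..<y} = {}" using KL(1) by blast
      have "(?K \<union> ?L) \<inter> {x..<y} = (I - {x, y}) \<inter> {x..<y}"
        using KL(2) sub that(2) by blast
      also have "\<dots> = {x<..<y}" using sub that(1) by auto
      finally show "(?K \<union> ?L) \<inter> {x..<y} = {x<..<y}" .
    qed
    \<comment> \<open>Modulo 2, the four positions add up to \<open>a + b + 1\<close> and the two
      sums over \<open>P\<close> and \<open>?P\<close> to \<open>a + b\<close>.\<close>
    have par: "odd ((position ?K a + position ?L b + \<Sum>P) + (position ?K b + position ?L a + \<Sum>?P))"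
    proof (cases "a < b")
      case True
      from swap[OF True refl] S show ?thesis by presburger
    next
      case False
      then have "b < a" using ab by simp
      from swap[OF this] S show ?thesis by (simp add: insert_commute) presburger
    qed
    then have "(-1 :: ypoly) ^ (position ?K b + position ?L a + \<Sum>?P) =
        - ((-1) ^ (position ?K a + position ?L b + \<Sum>P))"
      by (auto simp: minus_one_power_iff)
    then have 3: "F (\<phi> z) = - F z"
      by (simp add: zP \<phi>_def F_def K L pos mult_ac)
    from 1 2 3 show ?thesis by blast
  qed
  have "(\<Sum>z\<in>Z. F z) = (\<Sum>z\<in>Z. - F z)"
    by (rule sum.reindex_bij_witness[where i = \<phi> and j = \<phi>]) (use \<phi> in auto)
  then have "(\<Sum>z\<in>Z. F z) = - (\<Sum>z\<in>Z. F z)" by (simp add: sum_negf)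
  then show ?thesis unfolding total by (rule minus_self_ypoly)
qed


subsection \<open>Dependence\<close>

text \<open>The relation between two minors lifts to diagrams: columns other than \<open>j1\<close>
  and \<open>j2\<close> are kept, which multiplies every term by the common factor
  \<open>rest\<close>. Terms whose diagram is not below \<open>D\<close> vanish, and one diagram
  below \<open>D\<close> keeps a coefficient of 1 or -1.\<close>

lemma dets_dependent:
  assumes D: "is_diagram n D" and j: "j1 < n" "j2 < n" "j1 \<noteq> j2" and pq: "p < q"
    and p: "p \<notin> column D j1" "p \<notin> column D j2" and q: "q \<in> column D j1" "q \<in> column D j2"
    and between: "\<And>i. p < i \<Longrightarrow> i < q \<Longrightarrow> i \<in> column D j1 \<longleftrightarrow> i \<notin> column D j2"
  shows "\<not> dets_independent n D"
proof
  assume ind: "dets_independent n D"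
  define A where "A = column D j1"
  define B where "B = column D j2"
  define I where "I = {p..q}"
  define T where "T = {P. P \<subseteq> I \<and> card P = card (A \<inter> I)}"
  define RA where "RA P = (A - I) \<union> P" for P
  define RB where "RB P = (B - I) \<union> (I - P)" for P
  define CP where "CP P = {(i, j). if j = j1 then i \<in> RA P else if j = j2 then i \<in> RB P else (i, j) \<in> D}"
    for P
  have A: "A \<subseteq> {..<n}" and B: "B \<subseteq> {..<n}" using column_subset[OF D] by (auto simp: A_def B_def)
  have finA: "finite A" and finB: "finite B" using A B finite_subset by auto
  have I: "I \<subseteq> {..<n}" using A q by (auto simp: I_def A_def)
  have col: "column (CP P) j1 = RA P" "column (CP P) j2 = RB P"
    "j \<noteq> j1 \<Longrightarrow> j \<noteq> j2 \<Longrightarrow> column (CP P) j = column D j" for P j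
    using j by (auto simp: CP_def column_def)
  let ?I = "diagrams_below n D"
  have finT: "finite T" by (simp add: T_def I_def)
  have inj: "inj_on CP T"
  proof
    fix P Q assume PQ: "P \<in> T" "Q \<in> T" "CP P = CP Q"
    then have "RA P = RA Q" using col(1) by metis
    then show "P = Q" using PQ by (auto simp: RA_def T_def)
  qed
  have sub: "RA P \<subseteq> {..<n}" "RB P \<subseteq> {..<n}" if "P \<in> T" for P
    using that A B I by (auto simp: RA_def RB_def T_def)
  have relation: "(\<Sum>P\<in>T. (-1) ^ (\<Sum>P) * (minor n (RA P) A * minor n (RB P) B)) = 0"
    unfolding T_def RA_def RB_def I_def
    by (rule two_minors_relation) (use A B pq p q between in \<open>auto simp: A_def B_def\<close>)
  define rest where "rest = (\<Prod>j\<in>{..<n} - {j1} - {j2}. minor n (column D j) (column D j))"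
  have det: "diagram_det n (CP P) D = minor n (RA P) A * minor n (RB P) B * rest" for P
  proof -
    have "diagram_det n (CP P) D = minor n (RA P) A * (minor n (RB P) B *
        (\<Prod>j\<in>{..<n} - {j1} - {j2}. minor n (column (CP P) j) (column D j)))"
      using j unfolding diagram_det_def
      by (simp add: prod.remove[of "{..<n}" j1] prod.remove[of "{..<n} - {j1}" j2] col A_def B_def)
    also have "(\<Prod>j\<in>{..<n} - {j1} - {j2}. minor n (column (CP P) j) (column D j)) = rest"
      unfolding rest_def by (rule prod.cong) (auto simp: col)
    finally show ?thesis by (simp add: mult_ac)
  qed
  have cardR: "card (RA P) = card A" "card (RB P) = card B" if P: "P \<in> T" for P
  proof -
    have fP: "finite P" "finite (I - P)" using P by (auto simp: T_def I_def intro: finite_subset)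
    show "card (RA P) = card A"
      unfolding RA_def by (rule card_replace_in[OF finA fP(1)]) (use P in \<open>auto simp: T_def\<close>)
    have "card (I - P) = card (B \<inter> I)"
      unfolding I_def B_def by (rule card_complement_in_interval[OF pq p q between])
        (use P in \<open>auto simp: T_def I_def A_def\<close>)
    then show "card (RB P) = card B"
      unfolding RB_def by (intro card_replace_in[OF finB fP(2)]) auto
  qed
  have below: "CP P \<in> ?I \<longleftrightarrow> fillings (RA P) A \<noteq> {} \<and> fillings (RB P) B \<noteq> {}" if P: "P \<in> T" for P
  proof -
    have "is_diagram n (CP P)"
      using sub[OF P] j D by (auto simp: CP_def is_diagram_def split: if_splits)
    then have "CP P \<in> ?I \<longleftrightarrow> (\<forall>j<n. gale_le (column (CP P) j) (column D j))"
      by (simp add: diagrams_below_def)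
    also have "\<dots> \<longleftrightarrow> gale_le (RA P) A \<and> gale_le (RB P) B"
    proof safe
      assume *: "\<forall>j<n. gale_le (column (CP P) j) (column D j)"
      show "gale_le (RA P) A" "gale_le (RB P) B"
        using *[rule_format, OF j(1)] *[rule_format, OF j(2)] by (simp_all add: col A_def B_def)
    next
      fix k assume *: "gale_le (RA P) A" "gale_le (RB P) B"
      show "gale_le (column (CP P) k) (column D k)"
      proof (cases "k = j1 \<or> k = j2")
        case True
        then show ?thesis using * col(1,2) by (auto simp: A_def B_def)
      next
        case False
        then show ?thesis by (simp add: col(3) gale_le_def)
      qed
    qed
    also have "\<dots> \<longleftrightarrow> fillings (RA P) A \<noteq> {} \<and> fillings (RB P) B \<noteq> {}"
    proof -
      have "finite (RA P)" "finite (RB P)"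
        using sub[OF P] by (auto intro: finite_subset)
      then show ?thesis using finA finB by (simp add: gale_le_iff_fillings)
    qed
    finally show ?thesis .
  qed
  have zero: "diagram_det n (CP P) D = 0" if P: "P \<in> T" "CP P \<notin> ?I" for P
  proof (cases "fillings (RA P) A = {}")
    case True
    then have "minor n (RA P) A = 0"
      using minor_eq_0[OF sub(1)[OF P(1)] A cardR(1)[OF P(1)]] by simp
    then show ?thesis by (simp add: det)
  next
    case False
    then have "fillings (RB P) B = {}" using below[OF P(1)] P(2) by blast
    then have "minor n (RB P) B = 0"
      using minor_eq_0[OF sub(2)[OF P(1)] B cardR(2)[OF P(1)]] by simp
    then show ?thesis by (simp add: det)
  qed
  \<comment> \<open>The set \<open>P\<close> is recovered from \<open>CP P\<close> as the part of
    column \<open>j1\<close> inside \<open>I\<close>, so the sign becomes a function of the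
    diagram.\<close>
  define a :: "diagram \<Rightarrow> complex"
    where "a C = (if C \<in> CP ` T then (-1) ^ (\<Sum>(column C j1 \<inter> I)) else 0)" for C
  have aCP: "a (CP P) = (-1) ^ (\<Sum>P)" if P: "P \<in> T" for P
  proof -
    have "column (CP P) j1 \<inter> I = P" using P by (auto simp: col RA_def T_def)
    then show ?thesis using P by (simp add: a_def)
  qed
  have yscale_sign: "yscale ((-1) ^ k) f = (-1) ^ k * f" for k f
    by (cases "even k") (simp_all add: ypoly.scale_minus_left)
  have "(\<Sum>C\<in>?I. yscale (a C) (diagram_det n C D)) =
      (\<Sum>C\<in>?I \<inter> CP ` T. yscale (a C) (diagram_det n C D))"
    by (rule sum.mono_neutral_right) (auto simp: finite_diagrams_below a_def)
  also have "\<dots> = (\<Sum>C\<in>CP ` T. yscale (a C) (diagram_det n C D))"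
    by (rule sum.mono_neutral_left) (use finT zero in auto)
  also have "\<dots> = (\<Sum>P\<in>T. (-1) ^ (\<Sum>P) * (minor n (RA P) A * minor n (RB P) B) * rest)"
    by (simp add: sum.reindex[OF inj] aCP yscale_sign det mult_ac)
  also have "\<dots> = 0"
    by (simp add: relation flip: sum_distrib_right)
  finally have a0: "\<forall>C\<in>?I. a C = 0"
    using ind unfolding dets_independent_def by blast
  \<comment> \<open>The witness of nontriviality: replacing \<open>q\<close> by \<open>p\<close> in
    the first column turns the second row set into \<open>B\<close> itself, and the first is filled
    by sending \<open>q\<close> to \<open>p\<close>.\<close>
  let ?P = "insert p (A \<inter> I - {q})"
  have pA: "p \<notin> A" "p \<notin> B" "q \<in> A" "q \<in> B" using p q by (auto simp: A_def B_def)
  have qI: "q \<in> I" "p \<in> I" using pq by (auto simp: I_def)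
  have "card (A \<inter> I) > 0" using pA qI finA by (auto simp: card_gt_0_iff)
  then have "card ?P = card (A \<inter> I)"
    using pA qI finA by (simp add: card_Diff_singleton)
  then have P: "?P \<in> T" using qI by (auto simp: T_def)
  have RA: "RA ?P = insert p (A - {q})" using qI by (auto simp: RA_def)
  have RB: "RB ?P = B"
    using qI pA between pq unfolding RB_def I_def A_def B_def by (auto simp: le_less)
  have "(\<lambda>s\<in>A. if s = q then p else s) \<in> fillings (RA ?P) A"
    unfolding fillings_def RA using pA pq
    by (auto simp: bij_betw_def inj_on_def image_iff)
  moreover have "(\<lambda>s\<in>B. s) \<in> fillings (RB ?P) B"
    unfolding fillings_def RB by (auto simp: bij_betw_def inj_on_def)
  ultimately have "CP ?P \<in> ?I" unfolding below[OF P] by blast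
  then have "a (CP ?P) = 0" using a0 by blast
  then show False by (simp add: aCP[OF P])
qed


section \<open>Attaining the upper bound and avoiding the configuration\<close>

theorem theorem1p1:
  fixes n :: nat and D :: diagram
  assumes "n \<ge> 1" and "is_diagram n D"
  shows "(\<forall>x. (\<forall>i<n. x i \<noteq> 0) \<longrightarrow>
            dual_weyl_char n D x = (\<Sum>C\<in>diagrams_below n D. diagram_monomial n x C))
    \<longleftrightarrow> \<not> (\<exists>i1 i2 j1 j2. i1 < i2 \<and> i2 < n \<and> j1 < j2 \<and> j2 < n \<and>
            (i1, j1) \<notin> D \<and> (i1, j2) \<notin> D \<and> (i2, j1) \<in> D \<and> (i2, j2) \<in> D)"
proof
  assume char: "\<forall>x. (\<forall>i<n. x i \<noteq> 0) \<longrightarrow>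
    dual_weyl_char n D x = (\<Sum>C\<in>diagrams_below n D. diagram_monomial n x C)"
  have ind: "dets_independent n D"
    by (rule independent_of_dual_weyl_char[OF assms(2)]) (use char[rule_format, of "\<lambda>_. 1"] in simp)
  show "\<not> (\<exists>i1 i2 j1 j2. i1 < i2 \<and> i2 < n \<and> j1 < j2 \<and> j2 < n \<and>
    (i1, j1) \<notin> D \<and> (i1, j2) \<notin> D \<and> (i2, j1) \<in> D \<and> (i2, j2) \<in> D)"
  proof
    assume "\<exists>i1 i2 j1 j2. i1 < i2 \<and> i2 < n \<and> j1 < j2 \<and> j2 < n \<and>
      (i1, j1) \<notin> D \<and> (i1, j2) \<notin> D \<and> (i2, j1) \<in> D \<and> (i2, j2) \<in> D"
    then obtain i1 i2 j1 j2 where i: "i1 < i2" and j: "j1 < j2" "j2 < n"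
      and "(i1, j1) \<notin> D" "(i1, j2) \<notin> D" "(i2, j1) \<in> D" "(i2, j2) \<in> D"
      by blast
    define A where "A = column D j1"
    define B where "B = column D j2"
    \<comment> \<open>Both columns stay fixed while the rows vary, and the pair with least distance
      is taken.\<close>
    let ?P = "\<lambda>(p, q). p < q \<and> p \<notin> A \<and> p \<notin> B \<and> q \<in> A \<and> q \<in> B"
    have "?P (i1, i2)"
      using i \<open>(i1, j1) \<notin> D\<close> \<open>(i1, j2) \<notin> D\<close> \<open>(i2, j1) \<in> D\<close> \<open>(i2, j2) \<in> D\<close>
      by (simp add: A_def B_def column_def)
    then obtain z where z: "?P z" and least: "\<And>w. ?P w \<Longrightarrow> snd z - fst z \<le> snd w - fst w"
      using ex_has_least_nat[of ?P "(i1, i2)" "\<lambda>z. snd z - fst z"] by blast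
    obtain p q where pq: "z = (p, q)" by fastforce
    have P: "p < q" "p \<notin> A" "p \<notin> B" "q \<in> A" "q \<in> B" using z unfolding pq by auto
    \<comment> \<open>A row \<open>i\<close> in both columns would make \<open>(p, i)\<close> a
      closer pair, a row in neither would do so for \<open>(i, q)\<close>.\<close>
    have "i \<in> A \<longleftrightarrow> i \<notin> B" if "p < i" "i < q" for i
      using least[of "(i, q)"] least[of "(p, i)"] that P unfolding pq by fastforce
    then have "\<not> dets_independent n D"
      using P j unfolding A_def B_def
      by (intro dets_dependent[OF assms(2), of j1 j2 p q]) auto
    with ind show False by contradiction
  qed
next
  assume none: "\<not> (\<exists>i1 i2 j1 j2. i1 < i2 \<and> i2 < n \<and> j1 < j2 \<and> j2 < n \<and>
    (i1, j1) \<notin> D \<and> (i1, j2) \<notin> D \<and> (i2, j1) \<in> D \<and> (i2, j2) \<in> D)"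
  have "column_avoiding n D"
    unfolding column_avoiding_def
  proof (intro allI impI)
    fix r s j k
    assume rs: "r < s" and jk: "j < n" "k < n" "j \<noteq> k" and s: "s \<in> column D j" "s \<in> column D k"
    have "s < n" using s(1) column_subset[OF assms(2)] by auto
    \<comment> \<open>\<open>column_avoiding\<close> is symmetric in the two columns, whereas the
      configuration orders them.\<close>
    moreover have "j < k \<or> k < j" using jk by auto
    ultimately show "r \<in> column D j \<or> r \<in> column D k"
      using none rs jk s unfolding column_def mem_Collect_eq by blast
  qed
  then have "dets_independent n D" by (rule dets_independent_of_avoiding[OF assms(2)])
  then show "\<forall>x. (\<forall>i<n. x i \<noteq> 0) \<longrightarrow>
    dual_weyl_char n D x = (\<Sum>C\<in>diagrams_below n D. diagram_monomial n x C)"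
    using dual_weyl_char_of_independent[OF assms(2)] by blast
qed

end
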